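(* Let $\mathcal E:=\mathbb C\setminus\{(-\infty,-1]\cup[1,+\infty)\}$. (1) Let $\tau=\{T;\mathfrak M,\mathfrak M,\mathcal K\}$ be a passive selfadjoint system and let $\Omega$ be its transfer function. Define $$T_{\mathbf\Phi}:=\begin{bmatrix}-P_{\mathfrak M}T\upharpoonright\mathfrak M&P_{\mathfrak M}D_T\\ D_T\upharpoonright\mathfrak M&T\end{bmatrix}:\ \mathfrak M\oplus\mathfrak D_T\to\mathfrak M\oplus\mathfrak D_T .$$ Then $T_{\mathbf\Phi}$ is a selfadjoint contraction and $\Omega_{\mathbf\Phi}(z)=(zI-\Omega(z))(I-z\Omega(z))^{-1}$ is the transfer function of the passive selfadjoint system $\tau_{\mathbf\Phi}=\{T_{\mathbf\Phi};\mathfrak M,\mathfrak M,\mathfrak D_T\}$. Moreover, if the system $\tau$ is minimal, then the system $\tau_{\mathbf\Phi}$ is minimal, too. (2) Let $T$ be a selfadjoint contraction in a Hilbert space $\mathfrak H$, let $\mathfrak M$ be a subspace of $\mathfrak H$ and let $M(\xi)=P_{\mathfrak M}(T-\xi I)^{-1}\upharpoonright\mathfrak M$, $\xi\in\mathbb C\setminus[-1,1]$. Let $T_{\mathbf\Phi}$ be defined by the same block formula as in (1) in the space $\mathfrak M\oplus\mathfrak D_T$ (a subspace of the Hilbert space $\widehat{\mathfrak H}:=\mathfrak M\oplus\mathfrak H$), and let $\widehat P_{\mathfrak M}$ be the orthogonal projection onto the first summand $\mathfrak M$. Then $$\frac{M^{-1}(\xi)}{\xi^2-1}=\widehat P_{\mathfrak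 M}(T_{\mathbf\Phi}-\xi I)^{-1}\upharpoonright\mathfrak M,\qquad \xi\in\mathbb C\setminus[-1,1].$$ (3) With $\Omega$ and $T_{\mathbf\Phi}$ as in (1), the function $$\widetilde\Omega(z)=(zI-T_{\mathbf\Phi})(I-zT_{\mathbf\Phi})^{-1},\qquad z\in\mathcal E,$$ satisfies $\Omega(z)=P_{\mathfrak M}\widetilde\Omega(z)\upharpoonright\mathfrak M$ for $z\in\mathcal E$, where $P_{\mathfrak M}$ denotes here the orthogonal projection in $\mathfrak M\oplus\mathfrak D_T$ onto the first summand $\mathfrak M$.
   Context: Hilbert spaces are complex and separable; subspaces are closed. A passive selfadjoint system $\tau=\{T;\mathfrak M,\mathfrak M,\mathcal K\}$ is given by a selfadjoint contraction $T=\begin{bmatrix}D&C\\C^*&F\end{bmatrix}$ in $\mathfrak M\oplus\mathcal K$ (input-output space $\mathfrak M$, state space $\mathcal K$); its transfer function is $\Omega(z)=D+zC(I-zF)^{-1}C^*$, $z\in\mathcal E$. The system is minimal if $\overline{\mathrm{span}}\{F^nC^*\mathfrak M:\ n\in\mathbb N_0\}=\mathcal K$. For a selfadjoint contraction $T$, $D_T=(I-T^2)^{1/2}$ and $\mathfrak D_T=\overline{\mathrm{ran}}\,D_T$, which is invariant under $T$. In (1), $P_{\mathfrak M}$ in the formula for $T_{\mathbf\Phi}$ is the orthogonal projection in $\mathfrak M\oplus\mathcal K$ onto $\mathfrak M$, the space $\mathfrak D_T$ is a subspace of $\mathfrak M\oplus\mathcal K$, and $\mathfrak M\oplus\mathfrak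 D_T$ is the external orthogonal sum; the lower right entry of $T_{\mathbf\Phi}$ is $T\upharpoonright\mathfrak D_T$ and the upper right one is $P_{\mathfrak M}D_T\upharpoonright\mathfrak D_T$. In (2) the same formula is used with $\mathfrak M\oplus\mathcal K$ replaced by $\mathfrak H$. *)

theory Defs
  imports "HOL-Analysis.Analysis"
begin

text \<open>
  Complex inner product spaces, layered over the real structure of the library: the norm,
  the topology and the real scalar multiplication are those of \<open>real_inner\<close>, and the real
  inner product is the real part of the complex one (linear in the first argument).
\<close>

class complex_inner = real_inner +
  fixes scaleC :: "complex \<Rightarrow> 'a \<Rightarrow> 'a" (infixr \<open>*\<^sub>C\<close> 75)
    and cinner :: "'a \<Rightarrow> 'a \<Rightarrow> complex"
  assumes scaleC_add_right: "a *\<^sub>C (x + y) = a *\<^sub>C x + a *\<^sub>C y"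
    and scaleC_add_left: "(a + b) *\<^sub>C x = a *\<^sub>C x + b *\<^sub>C x"
    and scaleC_scaleC: "a *\<^sub>C (b *\<^sub>C x) = (a * b) *\<^sub>C x"
    and scaleC_of_real: "complex_of_real r *\<^sub>C x = r *\<^sub>R x"
    and cinner_commute: "cinner x y = cnj (cinner y x)"
    and cinner_add_left: "cinner (x + y) z = cinner x z + cinner y z"
    and cinner_scaleC_left: "cinner (a *\<^sub>C x) y = a * cinner x y"
    and Re_cinner: "Re (cinner x y) = inner x y"

text \<open>For metric spaces, second countability is separability.\<close>

class separable_hilbert_space = complex_inner + complete_space + second_countable_topology

global_interpretation complex_vector: vector_space "scaleC :: complex \<Rightarrow> 'a \<Rightarrow> 'a::complex_inner"
proof
  show "1 *\<^sub>C x = x" for x :: 'a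
    using scaleC_of_real[of 1 x] by simp
qed (simp_all add: scaleC_add_right scaleC_add_left scaleC_scaleC)

instantiation prod :: (complex_inner, complex_inner) complex_inner
begin

definition scaleC_prod :: "complex \<Rightarrow> 'a \<times> 'b \<Rightarrow> 'a \<times> 'b" where
  "scaleC_prod c p = (c *\<^sub>C fst p, c *\<^sub>C snd p)"

definition cinner_prod :: "'a \<times> 'b \<Rightarrow> 'a \<times> 'b \<Rightarrow> complex" where
  "cinner_prod p q = cinner (fst p) (fst q) + cinner (snd p) (snd q)"

instance
proof
  show "cinner p q = cnj (cinner q p)" for p q :: "'a \<times> 'b"
    unfolding cinner_prod_def complex_cnj_add
    using cinner_commute[of "fst p" "fst q"] cinner_commute[of "snd p" "snd q"] by simp
qed (simp_all add: scaleC_prod_def cinner_prod_def scaleC_add_right scaleC_add_left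
      scaleC_scaleC scaleC_of_real cinner_add_left cinner_scaleC_left Re_cinner
      scaleR_prod_def inner_prod_def algebra_simps)

end

instance prod :: (separable_hilbert_space, separable_hilbert_space) separable_hilbert_space ..

text \<open>
  A Hilbert space is rendered as a closed subspace \<open>H\<close> of a type of class
  \<open>separable_hilbert_space\<close> (the whole type being a special case), and an operator on \<open>H\<close> as a
  function whose values outside \<open>H\<close> are irrelevant. The orthogonal sum of \<open>M\<close> and \<open>K\<close> is
  \<open>M \<times> K\<close> in the product type.
\<close>

definition hilbert_subspace :: "'a::separable_hilbert_space set \<Rightarrow> bool" where
  "hilbert_subspace H \<longleftrightarrow> complex_vector.subspace H \<and> closed H"

definition bounded_op_on :: "'a::separable_hilbert_space set \<Rightarrow> ('a \<Rightarrow> 'a) \<Rightarrow> bool" where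
  "bounded_op_on H A \<longleftrightarrow> A \<in> H \<rightarrow> H \<and>
     (\<forall>x\<in>H. \<forall>y\<in>H. A (x + y) = A x + A y) \<and>
     (\<forall>c. \<forall>x\<in>H. A (c *\<^sub>C x) = c *\<^sub>C A x) \<and>
     (\<exists>B. \<forall>x\<in>H. norm (A x) \<le> B * norm x)"

definition selfadjoint_on :: "'a::separable_hilbert_space set \<Rightarrow> ('a \<Rightarrow> 'a) \<Rightarrow> bool" where
  "selfadjoint_on H A \<longleftrightarrow> bounded_op_on H A \<and> (\<forall>x\<in>H. \<forall>y\<in>H. cinner (A x) y = cinner x (A y))"

definition selfadjoint_contraction_on :: "'a::separable_hilbert_space set \<Rightarrow> ('a \<Rightarrow> 'a) \<Rightarrow> bool" where
  "selfadjoint_contraction_on H A \<longleftrightarrow> selfadjoint_on H A \<and> (\<forall>x\<in>H. norm (A x) \<le> norm x)"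

definition positive_on :: "'a::separable_hilbert_space set \<Rightarrow> ('a \<Rightarrow> 'a) \<Rightarrow> bool" where
  "positive_on H A \<longleftrightarrow> selfadjoint_on H A \<and> (\<forall>x\<in>H. 0 \<le> Re (cinner (A x) x))"

text \<open>The inverse of an operator \<open>A\<close> invertible on \<open>H\<close> is written \<open>inv_into H A\<close>.\<close>

definition invertible_on :: "'a::separable_hilbert_space set \<Rightarrow> ('a \<Rightarrow> 'a) \<Rightarrow> bool" where
  "invertible_on H A \<longleftrightarrow> bounded_op_on H A \<and> bij_betw A H H \<and> bounded_op_on H (inv_into H A)"

definition orth_proj :: "'a::separable_hilbert_space set \<Rightarrow> 'a \<Rightarrow> 'a" where
  "orth_proj M x = (THE y. y \<in> M \<and> (\<forall>m\<in>M. cinner (x - y) m = 0))"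

text \<open>The positive square root; extensionality on \<open>H\<close> makes the representing function unique.\<close>

definition op_sqrt :: "'a::separable_hilbert_space set \<Rightarrow> ('a \<Rightarrow> 'a) \<Rightarrow> 'a \<Rightarrow> 'a" where
  "op_sqrt H A = (THE S. S \<in> extensional H \<and> positive_on H S \<and> (\<forall>x\<in>H. S (S x) = A x))"

definition defect_op :: "'a::separable_hilbert_space set \<Rightarrow> ('a \<Rightarrow> 'a) \<Rightarrow> 'a \<Rightarrow> 'a" where
  "defect_op H T = op_sqrt H (\<lambda>x. x - T (T x))"

definition defect_space :: "'a::separable_hilbert_space set \<Rightarrow> ('a \<Rightarrow> 'a) \<Rightarrow> 'a set" where
  "defect_space H T = closure (defect_op H T ` H)"

text \<open>
  The entries \<open>D\<close>, \<open>C\<close>, \<open>C\<^sup>*\<close>, \<open>F\<close> of a block operator on \<open>M \<times> K\<close>. The lower left entry is the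
  adjoint of \<open>C\<close> whenever the block operator is selfadjoint.
\<close>

definition blk_D :: "('m::zero \<times> 'k::zero \<Rightarrow> 'm \<times> 'k) \<Rightarrow> 'm \<Rightarrow> 'm" where
  "blk_D T m = fst (T (m, 0))"

definition blk_C :: "('m::zero \<times> 'k::zero \<Rightarrow> 'm \<times> 'k) \<Rightarrow> 'k \<Rightarrow> 'm" where
  "blk_C T k = fst (T (0, k))"

definition blk_Cadj :: "('m::zero \<times> 'k::zero \<Rightarrow> 'm \<times> 'k) \<Rightarrow> 'm \<Rightarrow> 'k" where
  "blk_Cadj T m = snd (T (m, 0))"

definition blk_F :: "('m::zero \<times> 'k::zero \<Rightarrow> 'm \<times> 'k) \<Rightarrow> 'k \<Rightarrow> 'k" where
  "blk_F T k = snd (T (0, k))"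

definition passive_selfadjoint_system ::
    "('m::separable_hilbert_space \<times> 'k::separable_hilbert_space \<Rightarrow> 'm \<times> 'k) \<Rightarrow> 'm set \<Rightarrow> 'k set \<Rightarrow> bool" where
  "passive_selfadjoint_system T M K \<longleftrightarrow>
     hilbert_subspace M \<and> hilbert_subspace K \<and> selfadjoint_contraction_on (M \<times> K) T"

definition minimal_system ::
    "('m::separable_hilbert_space \<times> 'k::separable_hilbert_space \<Rightarrow> 'm \<times> 'k) \<Rightarrow> 'm set \<Rightarrow> 'k set \<Rightarrow> bool" where
  "minimal_system T M K \<longleftrightarrow>
     closure (complex_vector.span {(blk_F T ^^ n) (blk_Cadj T m) |n m. m \<in> M}) = K"

definition transfer_function ::
    "('m::separable_hilbert_space \<times> 'k::separable_hilbert_space \<Rightarrow> 'm \<times> 'k) \<Rightarrow> 'k set \<Rightarrow>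
     complex \<Rightarrow> 'm \<Rightarrow> 'm" where
  "transfer_function T K z m =
     blk_D T m + z *\<^sub>C blk_C T (inv_into K (\<lambda>k. k - z *\<^sub>C blk_F T k) (blk_Cadj T m))"

definition cut_plane :: "complex set" where
  "cut_plane = UNIV - complex_of_real ` ({..-1} \<union> {1..})"

text \<open>
  The block operator \<open>T\<^sub>\<Phi>\<close> on \<open>M \<times> defect_space H T\<close>, where the isometry \<open>J\<close> embeds \<open>M\<close> into \<open>H\<close>
  and \<open>P\<close> is the orthogonal projection of \<open>H\<close> onto the image of \<open>J\<close>, read as a map into \<open>M\<close>:
  for a subspace \<open>M\<close> of \<open>H\<close>, \<open>P = orth_proj M\<close> and \<open>J m = m\<close>; for the first summand of
  \<open>H = M \<times> K\<close>, \<open>P = fst\<close> and \<open>J m = (m, 0)\<close>.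
\<close>

definition T_Phi ::
    "('h::separable_hilbert_space \<Rightarrow> 'm::separable_hilbert_space) \<Rightarrow> ('m \<Rightarrow> 'h) \<Rightarrow>
     'h set \<Rightarrow> ('h \<Rightarrow> 'h) \<Rightarrow> 'm \<times> 'h \<Rightarrow> 'm \<times> 'h" where
  "T_Phi P J H T = (\<lambda>(m, h). (- P (T (J m)) + P (defect_op H T h), defect_op H T (J m) + T h))"

end

theory Submission
  imports Defs
begin

text \<open>
  Since \<open>T\<close> and \<open>D\<^sub>T\<close> commute and \<open>T\<^sup>2 + D\<^sub>T\<^sup>2 = I\<close>, the block operator with rows \<open>(- T, D\<^sub>T)\<close> and
  \<open>(D\<^sub>T, T)\<close> is selfadjoint and unitary, and \<open>T\<^sub>\<Phi>\<close> is its compression to \<open>M \<times> \<DD>\<^sub>T\<close>, hence a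
  selfadjoint contraction. The functions \<open>(I - z \<Omega>(z))\<^sup>-\<^sup>1\<close> and \<open>M(\<xi>)\<close> are compressions of resolvents,
  and the three formulas are Schur complement computations in which \<open>D\<^sub>T\<close> only enters through
  \<open>D\<^sub>T\<^sup>2 = I - T\<^sup>2\<close>. Every inverse exists because the numerical range of a selfadjoint contraction lies
  in \<open>[-1, 1]\<close>, which a line separates from any \<open>\<xi>\<close> outside it (Lax--Milgram). The square root
  \<open>D\<^sub>T\<close> is the binomial series of \<open>(1 - x)\<^sup>1\<^sup>/\<^sup>2\<close> at \<open>x = T\<^sup>2\<close>, which converges absolutely even for
  \<open>\<parallel>T\<parallel> = 1\<close>.
\<close>

text \<open>The state operator of \<open>T_Phi\<close> is the whole of \<open>T\<close>, and D (I -
  z T) = (I - z T) D. So on a vector D (J m) the resolvent of the new state operator is D applied to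
  the resolvent of \<open>T\<close>. This makes the transfer function of \<open>T_Phi\<close> the
  compression to M of (z I - T) (I - z T)^{-1}. Eliminating the state from the blocks of
  \<open>T\<close> shows that the same compression is (z I - \<Omega>(z)) (I - z \<Omega>(z))^{-1},
  and (1) equates the two. The computations are done on single vectors, each inverse being replaced
  by the solution of its equation. Since \<open>defect_op\<close> is a definite description,
  uniqueness of the positive square root must be settled before anything is known about D.\<close>

instance separable_hilbert_space \<subseteq> banach ..

section \<open>Complex inner products and subspaces\<close>

lemma cinner_add_right: "cinner x (y + z) = cinner x y + cinner x z"
  by (metis cinner_add_left cinner_commute complex_cnj_add)

lemma cinner_scaleC_right: "cinner x (a *\<^sub>C y) = cnj a * cinner x y"
  by (metis cinner_commute cinner_scaleC_left complex_cnj_mult)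

lemma cinner_minus_left: "cinner (- x) y = - cinner x y"
  using cinner_scaleC_left[of "-1" x y] by simp

lemma cinner_minus_right: "cinner x (- y) = - cinner x y"
  using cinner_scaleC_right[of x "-1" y] by simp

lemma cinner_diff_left: "cinner (x - y) z = cinner x z - cinner y z"
  using cinner_add_left[of x "- y" z] by (simp add: cinner_minus_left)

lemma cinner_diff_right: "cinner x (y - z) = cinner x y - cinner x z"
  using cinner_add_right[of x y "- z"] by (simp add: cinner_minus_right)

lemma cinner_zero_left [simp]: "cinner 0 x = 0"
  using cinner_diff_left[of x x x] by simp

lemma cinner_zero_right [simp]: "cinner x 0 = 0"
  using cinner_diff_right[of x x x] by simp

lemmas cinner_simps = cinner_add_left cinner_add_right cinner_diff_left cinner_diff_right
  cinner_minus_left cinner_minus_right cinner_scaleC_left cinner_scaleC_right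

text \<open>Multiplying the second argument by \<i> moves the imaginary part into the real inner
  product, so real symmetry or orthogonality on a complex subspace lifts to the complex one.\<close>

lemma cinner_eq_Complex: "cinner x y = Complex (inner x y) (inner x (\<i> *\<^sub>C y))"
  by (rule complex_eqI) (simp_all flip: Re_cinner add: cinner_scaleC_right)

lemma cinner_self: "cinner x x = of_real ((norm x)\<^sup>2)"
proof -
  have "Im (cinner x x) = 0"
    using arg_cong[OF cinner_commute[of x x], of Im] by simp
  then show ?thesis
    by (intro complex_eqI) (simp_all add: Re_cinner dot_square_norm)
qed

lemma norm_scaleC: "norm (a *\<^sub>C x) = cmod a * norm x"
proof -
  have "complex_of_real ((norm (a *\<^sub>C x))\<^sup>2) = of_real ((cmod a * norm x)\<^sup>2)"
    unfolding cinner_self[symmetric] cinner_scaleC_left cinner_scaleC_right power_mult_distrib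
    by (simp add: cinner_self) (simp add: complex_norm_square mult.commute flip: of_real_power)
  then have "(norm (a *\<^sub>C x))\<^sup>2 = (cmod a * norm x)\<^sup>2"
    unfolding of_real_eq_iff .
  then show ?thesis
    by (simp add: power2_eq_iff_nonneg)
qed

lemma bounded_linear_scaleC: "bounded_linear (\<lambda>x. a *\<^sub>C x)"
proof (rule bounded_linear_intro[where K = "cmod a"])
  show "a *\<^sub>C (r *\<^sub>R x) = r *\<^sub>R a *\<^sub>C x" for r x
    by (simp flip: scaleC_of_real add: scaleC_scaleC mult.commute)
qed (simp_all add: scaleC_add_right norm_scaleC mult.commute)

lemma hilbert_subspaceD:
  assumes "hilbert_subspace H"
  shows hs_zero: "0 \<in> H"
    and hs_add: "x \<in> H \<Longrightarrow> y \<in> H \<Longrightarrow> x + y \<in> H"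
    and hs_diff: "x \<in> H \<Longrightarrow> y \<in> H \<Longrightarrow> x - y \<in> H"
    and hs_minus: "x \<in> H \<Longrightarrow> - x \<in> H"
    and hs_scaleC: "x \<in> H \<Longrightarrow> c *\<^sub>C x \<in> H"
    and hs_scaleR: "x \<in> H \<Longrightarrow> r *\<^sub>R x \<in> H"
    and hs_closed: "closed H"
  using assms complex_vector.subspace_scale[of H x "of_real r"] unfolding hilbert_subspace_def
  by (auto simp: complex_vector.subspace_0 complex_vector.subspace_add complex_vector.subspace_diff
      complex_vector.subspace_neg complex_vector.subspace_scale scaleC_of_real)

lemma hs_complete: "hilbert_subspace H \<Longrightarrow> complete H"
  by (simp add: complete_eq_closed hs_closed)

lemma hilbert_subspace_Times:
  assumes "hilbert_subspace M" "hilbert_subspace K"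
  shows "hilbert_subspace (M \<times> K)"
  using assms unfolding hilbert_subspace_def complex_vector.subspace_def
  by (auto simp: scaleC_prod_def zero_prod_def closed_Times)

lemma hilbert_subspace_closure:
  assumes "complex_vector.subspace S"
  shows "hilbert_subspace (closure S)"
  unfolding hilbert_subspace_def complex_vector.subspace_def
proof (intro conjI ballI allI)
  show "0 \<in> closure S"
    using assms closure_subset by (auto simp: complex_vector.subspace_def)
  show "x + y \<in> closure S" if xy: "x \<in> closure S" "y \<in> closure S" for x y
  proof -
    obtain f g where "\<forall>n. f n \<in> S" "f \<longlonglongrightarrow> x" "\<forall>n. g n \<in> S" "g \<longlonglongrightarrow> y"
      using xy unfolding closure_sequential by blast
    then have "(\<lambda>n. f n + g n) \<longlonglongrightarrow> x + y" "\<And>n. f n + g n \<in> S"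
      using assms by (auto intro: tendsto_add simp: complex_vector.subspace_def)
    then show ?thesis
      unfolding closure_sequential by (intro exI conjI allI)
  qed
  show "c *\<^sub>C x \<in> closure S" if x: "x \<in> closure S" for x c
  proof -
    obtain f where "\<And>n. f n \<in> S" "f \<longlonglongrightarrow> x"
      using x by (auto simp: closure_sequential)
    then have "(\<lambda>n. c *\<^sub>C f n) \<longlonglongrightarrow> c *\<^sub>C x" "\<And>n. c *\<^sub>C f n \<in> S"
      using assms
      by (auto intro: bounded_linear.tendsto[OF bounded_linear_scaleC]
          simp: complex_vector.subspace_def)
    then show ?thesis
      unfolding closure_sequential by (intro exI conjI allI)
  qed
qed simp

section \<open>Bounded operators and coercivity\<close>

locale bounded_operator =
  fixes H :: "'a::separable_hilbert_space set" and A :: "'a \<Rightarrow> 'a"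
  assumes H: "hilbert_subspace H" and A: "bounded_op_on H A"
begin

lemma closed_op: "x \<in> H \<Longrightarrow> A x \<in> H"
  using A by (auto simp: bounded_op_on_def)

lemma add: "x \<in> H \<Longrightarrow> y \<in> H \<Longrightarrow> A (x + y) = A x + A y"
  using A by (auto simp: bounded_op_on_def)

lemma scaleC: "x \<in> H \<Longrightarrow> A (c *\<^sub>C x) = c *\<^sub>C A x"
  using A by (auto simp: bounded_op_on_def)

lemma scaleR: "x \<in> H \<Longrightarrow> A (r *\<^sub>R x) = r *\<^sub>R A x"
  using scaleC[of x "of_real r"] by (simp add: scaleC_of_real)

lemma minus: "x \<in> H \<Longrightarrow> A (- x) = - A x"
  using scaleC[of x "-1"] by simp

lemma diff: "x \<in> H \<Longrightarrow> y \<in> H \<Longrightarrow> A (x - y) = A x - A y"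
  using add[of x "- y"] by (simp add: minus hs_minus[OF H])

lemma zero: "A 0 = 0"
  using diff[of 0 0] hs_zero[OF H] by simp

lemma bound: obtains b where "b > 0" "\<And>x. x \<in> H \<Longrightarrow> norm (A x) \<le> b * norm x"
proof -
  obtain b where b: "\<And>x. x \<in> H \<Longrightarrow> norm (A x) \<le> b * norm x"
    using A unfolding bounded_op_on_def by blast
  have "norm (A x) \<le> (\<bar>b\<bar> + 1) * norm x" if "x \<in> H" for x
    using b[OF that] by (smt (verit) mult_right_mono norm_ge_zero)
  then show thesis
    by (intro that[of "\<bar>b\<bar> + 1"]) auto
qed

lemma continuous: "continuous_on H A"
proof -
  obtain b where b: "b > 0" "\<And>x. x \<in> H \<Longrightarrow> norm (A x) \<le> b * norm x"
    using bound by blast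
  have "b-lipschitz_on H A"
    using b by (auto intro!: lipschitz_onI simp: dist_norm hs_diff[OF H] simp flip: diff)
  then show ?thesis
    by (rule lipschitz_on_continuous_on)
qed

lemma tendsto:
  assumes "\<And>n. f n \<in> H" "f \<longlonglongrightarrow> x"
  shows "(\<lambda>n. A (f n)) \<longlonglongrightarrow> A x"
proof -
  have "x \<in> H"
    using closed_sequentially[OF hs_closed[OF H]] assms by blast
  then show ?thesis
    using continuous assms unfolding continuous_on_sequentially by (auto simp: o_def)
qed

lemma sum_in: "(\<And>i. i \<in> I \<Longrightarrow> f i \<in> H) \<Longrightarrow> sum f I \<in> H"
  by (induction I rule: infinite_finite_induct) (auto simp: hs_zero[OF H] hs_add[OF H])

lemma sum: "(\<And>i. i \<in> I \<Longrightarrow> f i \<in> H) \<Longrightarrow> A (sum f I) = (\<Sum>i\<in>I. A (f i))"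
  by (induction I rule: infinite_finite_induct) (auto simp: zero add sum_in)

lemma sums_in:
  assumes "\<And>n. f n \<in> H" "f sums s"
  shows "s \<in> H"
proof -
  have "\<And>n. (\<Sum>i<n. f i) \<in> H" "(\<lambda>n. \<Sum>i<n. f i) \<longlonglongrightarrow> s"
    using assms by (auto simp: sums_def intro: sum_in)
  then show ?thesis
    using closed_sequentially[OF hs_closed[OF H], of "\<lambda>n. \<Sum>i<n. f i" s] by simp
qed

lemma sums:
  assumes "\<And>n. f n \<in> H" "f sums s"
  shows "(\<lambda>n. A (f n)) sums A s"
proof -
  have "\<And>n. (\<Sum>i<n. f i) \<in> H" "(\<lambda>n. \<Sum>i<n. f i) \<longlonglongrightarrow> s"
    using assms by (auto simp: sums_def intro: sum_in)
  from tendsto[OF this] show ?thesis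
    using assms(1) by (simp add: sums_def sum)
qed

lemma funpow_in: "x \<in> H \<Longrightarrow> (A ^^ n) x \<in> H"
  by (induction n) (auto intro: closed_op)

lemma bounded_operator_affine: "bounded_op_on H (\<lambda>x. a *\<^sub>C x + c *\<^sub>C A x)"
  unfolding bounded_op_on_def
proof (intro conjI ballI allI)
  obtain b where b: "b > 0" "\<And>x. x \<in> H \<Longrightarrow> norm (A x) \<le> b * norm x"
    using bound by blast
  have "norm (a *\<^sub>C x + c *\<^sub>C A x) \<le> (cmod a + cmod c * b) * norm x" if "x \<in> H" for x
    using norm_triangle_ineq[of "a *\<^sub>C x" "c *\<^sub>C A x"] mult_left_mono[OF b(2)[OF that], of "cmod c"]
    by (simp add: norm_scaleC algebra_simps)
  then show "\<exists>b. \<forall>x\<in>H. norm (a *\<^sub>C x + c *\<^sub>C A x) \<le> b * norm x"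
    by blast
qed (auto simp: add scaleC scaleC_add_right scaleC_scaleC mult.commute algebra_simps
    intro!: hs_add[OF H] hs_scaleC[OF H] closed_op)

text \<open>Lax--Milgram: for small \<open>t > 0\<close> the map \<open>x \<mapsto> x - t e (A x - y)\<close> is a contraction.\<close>

lemma coercive_invertible:
  assumes d: "d > 0" and coercive: "\<And>x. x \<in> H \<Longrightarrow> d * (norm x)\<^sup>2 \<le> Re (e * cinner (A x) x)"
  shows "invertible_on H A" and "\<And>x. x \<in> H \<Longrightarrow> d * norm x \<le> cmod e * norm (A x)"
proof -
  obtain b where b: "b > 0" "\<And>x. x \<in> H \<Longrightarrow> norm (A x) \<le> b * norm x"
    using bound by blast
  show lower: "d * norm x \<le> cmod e * norm (A x)" if "x \<in> H" for x
  proof (cases "x = 0")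
    case False
    have "d * (norm x)\<^sup>2 \<le> inner (e *\<^sub>C A x) x"
      using coercive[OF that] by (simp flip: Re_cinner add: cinner_scaleC_left)
    also have "\<dots> \<le> cmod e * norm (A x) * norm x"
      using norm_cauchy_schwarz[of "e *\<^sub>C A x" x] by (simp add: norm_scaleC)
    finally show ?thesis
      using False by (simp add: power2_eq_square)
  qed (use zero in simp)
  have inj: "inj_on A H"
  proof (rule inj_onI)
    fix x y assume "x \<in> H" "y \<in> H" "A x = A y"
    then have "d * norm (x - y) \<le> 0"
      using lower[of "x - y"] by (simp add: diff hs_diff[OF H])
    then show "x = y"
      using d by (simp add: mult_le_0_iff)
  qed
  have "\<exists>x\<in>H. A x = y" if "y \<in> H" for y
  proof -
    \<comment> \<open>The summand (\<open>cmod e * b\<close>)^2 bounds the squared norm of e A, so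
      the quadratic term in t is at most t * (t * Q) = t * d, half of the linear gain; 1 + d^2
      forces t * d < 1.\<close>
    define Q where "Q = 1 + d\<^sup>2 + (cmod e * b)\<^sup>2"
    define t where "t = d / Q"
    define f where "f x = x - (of_real t * e) *\<^sub>C (A x - y)" for x
    have Q: "Q > 0"
      unfolding Q_def by (smt (verit) zero_le_power2)
    have t: "t > 0"
      using d Q by (simp add: t_def)
    have tQ: "t * Q = d"
      using Q by (simp add: t_def)
    have "t * d * Q = d\<^sup>2"
      using tQ by (simp add: power2_eq_square algebra_simps)
    also have "\<dots> < Q"
      unfolding Q_def by (smt (verit) zero_le_power2)
    finally have td: "t * d < 1"
      using Q by simp
    have contr: "dist (f x) (f x') \<le> (1 - t * d / 2) * dist x x'" if xy: "x \<in> H" "x' \<in> H" for x x'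
    proof -
      define u where "u = x - x'"
      have u: "u \<in> H"
        using xy by (simp add: u_def hs_diff[OF H])
      have "f x - f x' = u - t *\<^sub>R e *\<^sub>C A u"
        using xy by (simp only: f_def u_def diff scaleC_scaleC[symmetric] scaleC_of_real
          complex_vector.scale_right_diff_distrib scaleR_diff_right) simp
      then have "(norm (f x - f x'))\<^sup>2
          = (norm u)\<^sup>2 - 2 * t * inner (e *\<^sub>C A u) u + t\<^sup>2 * (norm (e *\<^sub>C A u))\<^sup>2"
        by (simp only: power2_norm_eq_inner inner_diff_left inner_diff_right inner_scaleR_left
            inner_scaleR_right inner_commute) (simp add: algebra_simps power2_eq_square)
      moreover have "d * (norm u)\<^sup>2 \<le> inner (e *\<^sub>C A u) u"
        using coercive[OF u] by (simp flip: Re_cinner add: cinner_scaleC_left)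
      then have "2 * t * (d * (norm u)\<^sup>2) \<le> 2 * t * inner (e *\<^sub>C A u) u"
        using t by (intro mult_left_mono) auto
      moreover have "norm (e *\<^sub>C A u) \<le> cmod e * b * norm u"
        using mult_left_mono[OF b(2)[OF u], of "cmod e"] by (simp add: norm_scaleC mult.assoc)
      then have "(norm (e *\<^sub>C A u))\<^sup>2 \<le> (cmod e * b * norm u)\<^sup>2"
        by (intro power_mono) auto
      then have "t\<^sup>2 * (norm (e *\<^sub>C A u))\<^sup>2 \<le> t * (t * Q) * (norm u)\<^sup>2"
      proof -
        have "(norm (e *\<^sub>C A u))\<^sup>2 \<le> Q * (norm u)\<^sup>2"
          using \<open>(norm (e *\<^sub>C A u))\<^sup>2 \<le> _\<close> unfolding Q_def power_mult_distrib
          by (smt (verit) mult_nonneg_nonneg zero_le_power2 distrib_right)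
        then show ?thesis
          using mult_left_mono[of _ _ "t\<^sup>2"] by (fastforce simp: power2_eq_square mult.assoc)
      qed
      ultimately have "(norm (f x - f x'))\<^sup>2 \<le> (1 - t * d) * (norm u)\<^sup>2"
        unfolding tQ by (simp add: algebra_simps)
      \<comment> \<open>Completing the square gives a contraction constant without a root.\<close>
      also have "\<dots> \<le> ((1 - t * d / 2) * norm u)\<^sup>2"
        unfolding power_mult_distrib using zero_le_power2[of "t * d"]
        by (intro mult_right_mono) (auto simp: power2_eq_square algebra_simps)
      finally show ?thesis
        using td by (simp add: dist_norm u_def power2_le_iff_abs_le)
    qed
    have "\<exists>!x\<in>H. f x = x"
    proof (rule Banach_fix[OF hs_complete[OF H] _ _ _ _ contr])
      show "f ` H \<subseteq> H"
        using \<open>y \<in> H\<close> by (auto simp: f_def intro!: hs_diff[OF H] hs_scaleC[OF H] closed_op)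
    qed (use hs_zero[OF H] td t d in auto)
    then obtain x where x: "x \<in> H" "f x = x"
      by blast
    then have "(of_real t * e) *\<^sub>C (A x - y) = 0"
      by (simp add: f_def)
    then have "e *\<^sub>C (A x - y) = 0"
      using t by auto
    \<comment> \<open>The lower bound allows \<open>e = 0\<close> only if H is trivial, and then A x
      = y = 0.\<close>
    moreover have "d * norm v \<le> 0" if "e = 0" "v \<in> H" for v
      using lower[of v] that by simp
    ultimately have "A x = y"
      using d x \<open>y \<in> H\<close> closed_op by (auto simp: mult_le_0_iff)
    with x show ?thesis
      by blast
  qed
  with inj have bij: "bij_betw A H H"
    by (auto simp: bij_betw_def closed_op)
  have inv: "inv_into H A y \<in> H" "A (inv_into H A y) = y" if "y \<in> H" for y
    using bij that by (auto simp: bij_betw_def inv_into_into f_inv_into_f)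
  have inv_eq: "inv_into H A y = x" if "x \<in> H" "A x = y" for x y
    using inj that by (metis inv_into_f_f)
  have "bounded_op_on H (inv_into H A)"
    unfolding bounded_op_on_def
  proof (intro conjI ballI allI)
    show "\<exists>b. \<forall>x\<in>H. norm (inv_into H A x) \<le> b * norm x"
      using lower[OF inv(1)] inv(2) d by (intro exI[of _ "cmod e / d"]) (auto simp: field_simps)
  qed (auto intro!: inv_eq simp: inv add scaleC hs_add[OF H] hs_scaleC[OF H])
  then show "invertible_on H A"
    using A bij by (simp add: invertible_on_def)
qed

end

lemma invertible_onD:
  assumes "invertible_on H A"
  shows inv_op_in: "y \<in> H \<Longrightarrow> inv_into H A y \<in> H"
    and op_inv_op: "y \<in> H \<Longrightarrow> A (inv_into H A y) = y"
    and inv_op_eq: "x \<in> H \<Longrightarrow> A x = y \<Longrightarrow> inv_into H A y = x"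
  using assms by (auto simp: invertible_on_def bij_betw_def inv_into_into f_inv_into_f inv_into_f_f)

section \<open>Resolvents of selfadjoint contractions\<close>

text \<open>The number \<open>e\<close> turns the normal of the separating line onto the positive
  real axis: it is 1 or -1 for real \<xi>, and \<i> or -\<i> otherwise, with distance
  \<open>\<bar>Im \<xi>\<bar>\<close>.\<close>

lemma cut_interval_separation:
  assumes "\<xi> \<notin> complex_of_real ` {-1..1}"
  obtains d e where "d > 0" "\<And>a. \<bar>a\<bar> \<le> 1 \<Longrightarrow> d \<le> Re (e * (of_real a - \<xi>))"
proof (cases "Im \<xi> = 0")
  case True
  then have \<xi>: "\<xi> = of_real (Re \<xi>)"
    by (simp add: complex_eq_iff)
  with assms have "\<bar>Re \<xi>\<bar> > 1"
    by (metis abs_le_iff atLeastAtMost_iff imageI minus_le_iff not_less)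
  then consider "Re \<xi> > 1" | "Re \<xi> < -1"
    by linarith
  then show thesis
  proof cases
    case 1
    then show thesis by (intro that[of "Re \<xi> - 1" "-1"]) auto
  next
    case 2
    then show thesis by (intro that[of "- 1 - Re \<xi>" 1]) auto
  qed
next
  case False
  then show thesis
    by (intro that[of "\<bar>Im \<xi>\<bar>" "\<i> * of_real (sgn (Im \<xi>))"]) (auto simp: abs_sgn zero_less_mult_iff sgn_if)
qed

lemma cut_plane_inverse:
  assumes "z \<in> cut_plane" "z \<noteq> 0"
  shows "inverse z \<notin> complex_of_real ` {-1..1}"
proof
  assume "inverse z \<in> complex_of_real ` {-1..1}"
  then obtain a where a: "inverse z = of_real a" "\<bar>a\<bar> \<le> 1"
    by auto
  then have "z = of_real (inverse a)"
    by (metis inverse_inverse_eq of_real_inverse)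
  moreover have "a \<noteq> 0"
    using a assms by auto
  then have "inverse a \<in> {..-1} \<union> {1..}"
    using a(2) by (cases "a > 0") (auto simp: field_simps)
  ultimately show False
    using assms(1) unfolding cut_plane_def by blast
qed

text \<open>Inversion maps the cut plane without 0 into the complement of [-1, 1]; factoring -z out
  of 1 - z a turns the multiplier e into -e / z.\<close>

lemma cut_plane_separation:
  assumes "z \<in> cut_plane"
  obtains d e where "d > 0" "\<And>a. \<bar>a\<bar> \<le> 1 \<Longrightarrow> d \<le> Re (e * (1 - z * of_real a))"
proof (cases "z = 0")
  case True
  then show thesis by (intro that[of 1 1]) auto
next
  case False
  obtain d e where ed: "d > 0" "\<And>a. \<bar>a\<bar> \<le> 1 \<Longrightarrow> d \<le> Re (e * (of_real a - inverse z))"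
    using cut_interval_separation[OF cut_plane_inverse[OF assms False]] by blast
  have "- e / z * (1 - z * of_real a) = e * (of_real a - inverse z)" for a
    using False by (simp add: field_simps)
  with ed show thesis
    by (intro that[of d "- e / z"]) metis+
qed

lemma cut_plane_square: "z \<in> cut_plane \<Longrightarrow> z\<^sup>2 \<noteq> 1"
  by (force simp: cut_plane_def power2_eq_1_iff)

locale selfadjoint_contraction =
  fixes H :: "'a::separable_hilbert_space set" and A :: "'a \<Rightarrow> 'a"
  assumes H': "hilbert_subspace H" and sac: "selfadjoint_contraction_on H A"
begin

sublocale bounded_operator H A
  by unfold_locales (use H' sac in \<open>auto simp: selfadjoint_contraction_on_def selfadjoint_on_def\<close>)

lemma sym: "x \<in> H \<Longrightarrow> y \<in> H \<Longrightarrow> cinner (A x) y = cinner x (A y)"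
  using sac by (auto simp: selfadjoint_contraction_on_def selfadjoint_on_def)

lemma contr: "x \<in> H \<Longrightarrow> norm (A x) \<le> norm x"
  using sac by (auto simp: selfadjoint_contraction_on_def)

lemma numerical_range:
  assumes "x \<in> H"
  obtains a where "\<bar>a\<bar> \<le> 1" "cinner (A x) x = of_real a * of_real ((norm x)\<^sup>2)"
proof (cases "x = 0")
  case True
  then show thesis by (intro that[of 0]) auto
next
  case False
  define r where "r = inner (A x) x"
  have "cinner (A x) x = cnj (cinner (A x) x)"
    using sym[OF assms assms] by (metis cinner_commute)
  then have "Im (cinner (A x) x) = 0"
    by (simp add: complex_eq_iff)
  then have r: "cinner (A x) x = of_real r"
    by (simp add: complex_eq_iff Re_cinner r_def)
  have "\<bar>r\<bar> \<le> norm (A x) * norm x"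
    unfolding r_def by (rule Cauchy_Schwarz_ineq2)
  also have "\<dots> \<le> (norm x)\<^sup>2"
    unfolding power2_eq_square using contr[OF assms] by (intro mult_right_mono) auto
  finally show thesis
    using False r by (intro that[of "r / (norm x)\<^sup>2"]) (auto simp: divide_le_eq)
qed

text \<open>At each x the quadratic form of \<alpha> I + \<gamma> A is (\<alpha> + \<gamma> a) times
  the squared norm for one real a in [-1, 1], so a scalar inequality on the interval becomes
  coercivity.\<close>

lemma affine_coercive:
  assumes "\<And>a. \<bar>a\<bar> \<le> 1 \<Longrightarrow> d \<le> Re (e * (\<alpha> + \<gamma> * of_real a))" "x \<in> H"
  shows "d * (norm x)\<^sup>2 \<le> Re (e * cinner (\<alpha> *\<^sub>C x + \<gamma> *\<^sub>C A x) x)"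
proof -
  obtain a where a: "\<bar>a\<bar> \<le> 1" "cinner (A x) x = of_real a * of_real ((norm x)\<^sup>2)"
    using numerical_range[OF assms(2)] .
  have "e * cinner (\<alpha> *\<^sub>C x + \<gamma> *\<^sub>C A x) x = (e * (\<alpha> + \<gamma> * of_real a)) * of_real ((norm x)\<^sup>2)"
    by (simp only: cinner_simps cinner_self a(2)) (simp add: algebra_simps)
  moreover have "Re (w * of_real r) = Re w * r" for w r
    by simp
  ultimately have "Re (e * cinner (\<alpha> *\<^sub>C x + \<gamma> *\<^sub>C A x) x) = Re (e * (\<alpha> + \<gamma> * of_real a)) * (norm x)\<^sup>2"
    by (simp only:)
  then show ?thesis
    using mult_right_mono[OF assms(1)[OF a(1)]] by (simp only: zero_le_power2)
qed

lemma affine_invertible: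
  assumes "d > 0" "\<And>a. \<bar>a\<bar> \<le> 1 \<Longrightarrow> d \<le> Re (e * (\<alpha> + \<gamma> * of_real a))"
  shows "invertible_on H (\<lambda>x. \<alpha> *\<^sub>C x + \<gamma> *\<^sub>C A x)"
proof -
  interpret aff: bounded_operator H "\<lambda>x. \<alpha> *\<^sub>C x + \<gamma> *\<^sub>C A x"
    by unfold_locales (simp_all add: H bounded_operator_affine)
  show ?thesis
    using aff.coercive_invertible(1)[OF assms(1)] affine_coercive[OF assms(2)] by blast
qed

lemma resolvent_invertible:
  assumes "\<xi> \<notin> complex_of_real ` {-1..1}"
  shows "invertible_on H (\<lambda>x. A x - \<xi> *\<^sub>C x)"
proof -
  obtain d e where ed: "d > 0" "\<And>a. \<bar>a\<bar> \<le> 1 \<Longrightarrow> d \<le> Re (e * (of_real a - \<xi>))"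
    using cut_interval_separation[OF assms] by blast
  then have "invertible_on H (\<lambda>x. (- \<xi>) *\<^sub>C x + 1 *\<^sub>C A x)"
    by (intro affine_invertible) auto
  then show ?thesis
    by simp
qed

lemma pencil_invertible:
  assumes "z \<in> cut_plane"
  shows "invertible_on H (\<lambda>x. x - z *\<^sub>C A x)"
proof -
  obtain d e where ed: "d > 0" "\<And>a. \<bar>a\<bar> \<le> 1 \<Longrightarrow> d \<le> Re (e * (1 - z * of_real a))"
    using cut_plane_separation[OF assms] by blast
  then have "invertible_on H (\<lambda>x. 1 *\<^sub>C x + (- z) *\<^sub>C A x)"
    by (intro affine_invertible) auto
  then show ?thesis
    by simp
qed

end

section \<open>The square root of \<open>I - A\<close>\<close>

definition sqrt_coeff :: "nat \<Rightarrow> real" where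
  "sqrt_coeff n = (1/2 gchoose n) * (-1) ^ n"

lemma sqrt_coeff_0 [simp]: "sqrt_coeff 0 = 1"
  by (simp add: sqrt_coeff_def)

text \<open>These are the Taylor coefficients of (1 - x)^{-1/2}: each factor -1/2 - i is negative,
  and the n signs cancel against (-1)^n.\<close>

lemma minus_half_gchoose_nonneg: "(-1) ^ n * (-1/2 gchoose n :: real) \<ge> 0"
proof -
  have "(-1/2 gchoose n :: real) = (\<Prod>i = 0..<n. (-1) * (1/2 + of_nat i)) / fact n"
    unfolding gbinomial_prod_rev by (intro arg_cong2[of _ _ _ _ "(/)"] prod.cong) auto
  also have "\<dots> = (-1) ^ n * (\<Prod>i = 0..<n. 1/2 + of_nat i) / fact n"
    by (simp only: prod.distrib prod_constant card_atLeastLessThan diff_zero)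
  finally have "(-1) ^ n * (-1/2 gchoose n :: real) = (\<Prod>i = 0..<n. 1/2 + of_nat i) / fact n"
    by (simp add: power_mult_distrib[symmetric] flip: power_add)
  also have "\<dots> \<ge> 0"
    by (intro divide_nonneg_nonneg prod_nonneg) auto
  finally show ?thesis .
qed

text \<open>Partial sums of coefficients belong to the series divided by 1 - x, here (1 - x)^{1/2} /
  (1 - x) = (1 - x)^{-1/2}.\<close>

lemma sum_sqrt_coeff_nonneg: "(\<Sum>k\<le>n. sqrt_coeff k) \<ge> 0"
  using minus_half_gchoose_nonneg[of n] gbinomial_sum_lower_neg[of "1/2 :: real" n]
  by (simp add: sqrt_coeff_def)

text \<open>Compare coefficients in the derivative -1/2 (1 - x)^{-1/2}.\<close>

lemma sqrt_coeff_Suc_nonpos: "sqrt_coeff (Suc n) \<le> 0"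
proof -
  have "real (Suc n) * (1/2 gchoose Suc n) = 1/2 * (-1/2 gchoose n)"
    using gbinomial_absorption[of n "1/2 :: real"] by simp
  then have "real (Suc n) * sqrt_coeff (Suc n) = - (1/2) * ((-1) ^ n * (-1/2 gchoose n))"
    by (simp add: sqrt_coeff_def)
  then have "real (Suc n) * sqrt_coeff (Suc n) \<le> 0"
    using minus_half_gchoose_nonneg[of n] by simp
  then show ?thesis
    by (simp add: mult_le_0_iff)
qed

text \<open>Only the coefficient 1 of index 0 is positive, so the absolute values add up to 2 minus
  a nonnegative partial sum.\<close>

lemma summable_sqrt_coeff: "summable (\<lambda>n. \<bar>sqrt_coeff n\<bar>)"
proof (rule bounded_imp_summable)
  have abs: "(\<Sum>k\<le>n. \<bar>sqrt_coeff k\<bar>) = 2 - (\<Sum>k\<le>n. sqrt_coeff k)" for n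
    by (induction n) (use sqrt_coeff_Suc_nonpos in auto)
  show "(\<Sum>k\<le>n. \<bar>sqrt_coeff k\<bar>) \<le> 2" for n
    unfolding abs using sum_sqrt_coeff_nonneg[of n] by simp
qed simp

text \<open>The series squares to 1 - x: Vandermonde's identity with 1/2 + 1/2 = 1.\<close>

lemma sqrt_coeff_convolution:
  "(\<Sum>i\<le>k. sqrt_coeff i * sqrt_coeff (k - i)) = (-1) ^ k * real (1 choose k)"
proof -
  have "(\<Sum>i\<le>k. sqrt_coeff i * sqrt_coeff (k - i))
      = (-1) ^ k * (\<Sum>i\<le>k. (1/2 gchoose i) * (1/2 gchoose (k - i)))"
    unfolding sum_distrib_left
    by (intro sum.cong) (auto simp: sqrt_coeff_def algebra_simps simp flip: power_add)
  also have "(\<Sum>i\<le>k. (1/2 gchoose i) * (1/2 gchoose (k - i))) = (1 gchoose k :: real)"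
    using gbinomial_Vandermonde[of "1/2 :: real" "1/2" k] by (simp add: atMost_atLeast0)
  finally show ?thesis
    by (simp add: binomial_gbinomial)
qed

section \<open>The binomial series evaluated at an operator\<close>

context selfadjoint_contraction
begin

definition rt :: "'a \<Rightarrow> 'a" where
  "rt x = (\<Sum>n. sqrt_coeff n *\<^sub>R (A ^^ n) x)"

lemma norm_funpow: "x \<in> H \<Longrightarrow> norm ((A ^^ n) x) \<le> norm x"
  by (induction n) (auto intro: order_trans[OF contr] funpow_in)

lemma summable_norm_rt:
  assumes "x \<in> H"
  shows "summable (\<lambda>n. norm (sqrt_coeff n *\<^sub>R (A ^^ n) x))"
proof (rule summable_comparison_test')
  show "summable (\<lambda>n. \<bar>sqrt_coeff n\<bar> * norm x)"
    by (rule summable_mult2[OF summable_sqrt_coeff])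
qed (use norm_funpow[OF assms] in \<open>auto intro: mult_left_mono\<close>)

lemma rt_sums: "x \<in> H \<Longrightarrow> (\<lambda>n. sqrt_coeff n *\<^sub>R (A ^^ n) x) sums rt x"
  unfolding rt_def by (rule summable_sums[OF summable_norm_cancel[OF summable_norm_rt]])

lemma rt_in: "x \<in> H \<Longrightarrow> rt x \<in> H"
  by (rule sums_in[OF _ rt_sums]) (auto intro: hs_scaleR[OF H] funpow_in)

text \<open>Applied with C = A, with C a competing square root of I - A, and, for the series in A^2,
  with C = A; the last gives the commutation of A and D.\<close>

lemma rt_commute:
  assumes "bounded_operator H C" "\<And>x. x \<in> H \<Longrightarrow> C (A x) = A (C x)" "x \<in> H"
  shows "C (rt x) = rt (C x)"
proof -
  interpret C: bounded_operator H C by fact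
  have "C ((A ^^ n) x) = (A ^^ n) (C x)" for n
    using assms(3) by (induction n) (auto simp: assms(2) funpow_in)
  moreover have "(\<lambda>n. C (sqrt_coeff n *\<^sub>R (A ^^ n) x)) sums C (rt x)"
    using assms(3) by (intro C.sums rt_sums) (auto intro: hs_scaleR[OF H] funpow_in)
  ultimately have "(\<lambda>n. sqrt_coeff n *\<^sub>R (A ^^ n) (C x)) sums C (rt x)"
    using assms(3) by (simp add: C.scaleR funpow_in)
  then show ?thesis
    using rt_sums[OF C.closed_op[OF assms(3)]] sums_unique2 by blast
qed

lemma funpow_additive: "x \<in> H \<Longrightarrow> y \<in> H \<Longrightarrow> (A ^^ n) (x + y) = (A ^^ n) x + (A ^^ n) y"
  by (induction n) (auto simp: add funpow_in)

lemma funpow_scaleC: "x \<in> H \<Longrightarrow> (A ^^ n) (c *\<^sub>C x) = c *\<^sub>C (A ^^ n) x"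
  by (induction n) (auto simp: scaleC funpow_in)

lemma funpow_sym: "x \<in> H \<Longrightarrow> y \<in> H \<Longrightarrow> cinner ((A ^^ n) x) y = cinner x ((A ^^ n) y)"
proof (induction n arbitrary: y)
  case (Suc n)
  then show ?case
    using sym[OF funpow_in[OF Suc.prems(1)] Suc.prems(2), of n] Suc.IH[OF _ closed_op]
    by (simp add: funpow_swap1)
qed simp

lemma rt_bounded: "bounded_op_on H rt"
  unfolding bounded_op_on_def
proof (intro conjI ballI allI)
  show "rt (x + y) = rt x + rt y" if "x \<in> H" "y \<in> H" for x y
  proof (rule sums_unique2[OF rt_sums])
    show "(\<lambda>n. sqrt_coeff n *\<^sub>R (A ^^ n) (x + y)) sums (rt x + rt y)"
      using sums_add[OF rt_sums rt_sums] that by (simp add: funpow_additive scaleR_add_right)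
  qed (use that in \<open>simp add: hs_add[OF H]\<close>)
  show "rt (c *\<^sub>C x) = c *\<^sub>C rt x" if "x \<in> H" for x c
  proof (rule sums_unique2[OF rt_sums])
    have "sqrt_coeff n *\<^sub>R (A ^^ n) (c *\<^sub>C x) = c *\<^sub>C sqrt_coeff n *\<^sub>R (A ^^ n) x" for n
      using that by (simp add: funpow_scaleC mult.commute scaleC_scaleC flip: scaleC_of_real)
    then show "(\<lambda>n. sqrt_coeff n *\<^sub>R (A ^^ n) (c *\<^sub>C x)) sums (c *\<^sub>C rt x)"
      using bounded_linear.sums[OF bounded_linear_scaleC rt_sums] that by simp
  qed (use that in \<open>simp add: hs_scaleC[OF H]\<close>)
  have "norm (rt x) \<le> (\<Sum>n. \<bar>sqrt_coeff n\<bar>) * norm x" if "x \<in> H" for x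
  proof -
    have "norm (rt x) \<le> (\<Sum>n. norm (sqrt_coeff n *\<^sub>R (A ^^ n) x))"
      unfolding rt_def by (rule summable_norm[OF summable_norm_rt[OF that]])
    also have "\<dots> \<le> (\<Sum>n. \<bar>sqrt_coeff n\<bar> * norm x)"
      using summable_norm_rt[OF that] norm_funpow[OF that]
      by (intro suminf_le summable_mult2 summable_sqrt_coeff) (auto intro: mult_left_mono)
    finally show ?thesis
      by (simp add: suminf_mult2[OF summable_sqrt_coeff])
  qed
  then show "\<exists>b. \<forall>x\<in>H. norm (rt x) \<le> b * norm x"
    by blast
qed (use rt_in in auto)

lemma rt_selfadjoint: "selfadjoint_on H rt"
proof -
  interpret rt: bounded_operator H rt
    by unfold_locales (simp_all add: H rt_bounded)
  have "inner (rt x) y = inner x (rt y)" if "x \<in> H" "y \<in> H" for x y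
  proof -
    have "inner ((A ^^ n) x) y = inner x ((A ^^ n) y)" for n
      using funpow_sym[OF that] by (metis Re_cinner)
    moreover have "(\<lambda>n. inner (sqrt_coeff n *\<^sub>R (A ^^ n) x) y) sums inner (rt x) y"
      by (intro bounded_linear.sums[OF bounded_linear_inner_left rt_sums] that)
    moreover have "(\<lambda>n. inner x (sqrt_coeff n *\<^sub>R (A ^^ n) y)) sums inner x (rt y)"
      by (intro bounded_linear.sums[OF bounded_linear_inner_right rt_sums] that)
    ultimately show ?thesis
      using sums_unique2 by force
  qed
  then show ?thesis
    using rt_bounded rt.scaleC hs_scaleC[OF H]
    by (auto simp: selfadjoint_on_def cinner_eq_Complex)
qed

text \<open>For n > 0 the coefficient is nonpositive and the form of A^n at x is at most the squared
  norm of x. Replacing every form by the squared norm therefore only lowers the sum, and leaves a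
  nonnegative partial sum of coefficients.\<close>

lemma rt_positive: "positive_on H rt"
  unfolding positive_on_def
proof (intro conjI ballI rt_selfadjoint)
  fix x assume x: "x \<in> H"
  have bound: "sqrt_coeff n * (norm x)\<^sup>2 \<le> inner (sqrt_coeff n *\<^sub>R (A ^^ n) x) x" for n
  proof (cases n)
    case (Suc m)
    have "inner ((A ^^ n) x) x \<le> norm ((A ^^ n) x) * norm x"
      by (rule norm_cauchy_schwarz)
    also have "\<dots> \<le> (norm x)\<^sup>2"
      unfolding power2_eq_square using norm_funpow[OF x] by (intro mult_right_mono) auto
    finally show ?thesis
      using sqrt_coeff_Suc_nonpos[of m] by (simp add: Suc mult_left_mono_neg)
  qed (simp add: power2_norm_eq_inner)
  have "(\<lambda>n. inner (sqrt_coeff n *\<^sub>R (A ^^ n) x) x) sums inner (rt x) x"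
    by (intro bounded_linear.sums[OF bounded_linear_inner_left rt_sums] x)
  then have "(\<lambda>n. \<Sum>k\<le>n. inner (sqrt_coeff k *\<^sub>R (A ^^ k) x) x) \<longlonglongrightarrow> inner (rt x) x"
    by (simp add: sums_def_le)
  moreover have "0 \<le> (\<Sum>k\<le>n. inner (sqrt_coeff k *\<^sub>R (A ^^ k) x) x)" for n
  proof -
    have "0 \<le> (\<Sum>k\<le>n. sqrt_coeff k) * (norm x)\<^sup>2"
      using sum_sqrt_coeff_nonneg by simp
    also have "\<dots> \<le> (\<Sum>k\<le>n. inner (sqrt_coeff k *\<^sub>R (A ^^ k) x) x)"
      unfolding sum_distrib_right by (intro sum_mono bound)
    finally show ?thesis .
  qed
  ultimately show "0 \<le> Re (cinner (rt x) x)"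
    unfolding Re_cinner by (intro LIMSEQ_le_const) auto
qed

text \<open>The double family f (m, n) is absolutely summable. Summed by rows it gives
  \<open>rt (rt x)\<close>; summed along the antidiagonals m + n = k it gives the Cauchy square of
  the series, which is 1 - x.\<close>

lemma rt_square:
  assumes x: "x \<in> H"
  shows "rt (rt x) = x - A x"
proof -
  define f where "f = (\<lambda>(m, n). (sqrt_coeff m * sqrt_coeff n) *\<^sub>R (A ^^ (m + n)) x)"
  define g where "g = (\<lambda>(m, n). \<bar>sqrt_coeff m\<bar> * \<bar>sqrt_coeff n\<bar> * norm x)"
  have coeff: "(\<lambda>n. \<bar>sqrt_coeff n\<bar>) summable_on UNIV"
    using summable_sqrt_coeff by (intro norm_summable_imp_summable_on) simp
  have "(\<lambda>p. norm (g p)) summable_on (UNIV \<times> UNIV)"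
    unfolding Infinite_Sum.abs_summable_on_Sigma_iff using coeff
    by (auto simp: g_def abs_mult infsum_cmult_right' infsum_cmult_left'
        intro!: summable_on_cmult_right summable_on_cmult_left)
  then have "(\<lambda>p. norm (f p)) summable_on (UNIV \<times> UNIV)"
  proof (rule Infinite_Sum.abs_summable_on_comparison_test)
    fix p :: "nat \<times> nat"
    show "norm (f p) \<le> norm (g p)"
      using norm_funpow[OF x, of "fst p + snd p"]
      by (auto simp: f_def g_def abs_mult split: prod.splits intro!: mult_left_mono)
  qed
  then have f: "f summable_on UNIV"
    using Infinite_Sum.abs_summable_summable[of f UNIV] by simp
  have comm: "(A ^^ m) (rt x) = rt ((A ^^ m) x)" for m
    by (induction m) (use rt_commute[OF bounded_operator_axioms] x in \<open>auto simp: funpow_in\<close>)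
  have row: "(\<Sum>\<^sub>\<infinity>n. f (m, n)) = sqrt_coeff m *\<^sub>R (A ^^ m) (rt x)" for m
  proof (rule infsumI[OF norm_summable_imp_has_sum])
    have Amx: "(A ^^ m) x \<in> H"
      using x by (rule funpow_in)
    have "(A ^^ n) ((A ^^ m) x) = (A ^^ (m + n)) x" for n
      by (simp add: funpow_add add.commute[of m n])
    then have f_eq: "f (m, n) = sqrt_coeff m *\<^sub>R sqrt_coeff n *\<^sub>R (A ^^ n) ((A ^^ m) x)" for n
      by (simp add: f_def)
    show "(\<lambda>n. f (m, n)) sums (sqrt_coeff m *\<^sub>R (A ^^ m) (rt x))"
      unfolding f_eq comm by (rule sums_scaleR_right[OF rt_sums[OF Amx]])
    show "summable (\<lambda>n. norm (f (m, n)))"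
      using summable_mult[OF summable_norm_rt[OF Amx], of "\<bar>sqrt_coeff m\<bar>"]
      by (simp add: f_eq abs_mult mult.assoc)
  qed
  have diag: "(\<Sum>i\<le>k. f (i, k - i)) = ((-1) ^ k * real (1 choose k)) *\<^sub>R (A ^^ k) x" for k
  proof -
    have "(\<Sum>i\<le>k. f (i, k - i)) = (\<Sum>i\<le>k. (sqrt_coeff i * sqrt_coeff (k - i)) *\<^sub>R (A ^^ k) x)"
      by (intro sum.cong) (auto simp: f_def)
    then show ?thesis
      by (simp only: sqrt_coeff_convolution flip: scaleR_sum_left)
  qed
  have "rt (rt x) = (\<Sum>\<^sub>\<infinity>m. \<Sum>\<^sub>\<infinity>n. f (m, n))"
    unfolding row using rt_in[OF x]
    by (intro infsumI[symmetric] norm_summable_imp_has_sum summable_norm_rt rt_sums)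
  also have "\<dots> = infsum f (UNIV \<times> UNIV)"
    by (rule infsum_Sigma_banach) (use f in simp)
  \<comment> \<open>The new indices are k = m + n and i = m.\<close>
  also have "\<dots> = infsum (\<lambda>(k, i). f (i, k - i)) (SIGMA k:UNIV. {..k})"
    by (rule infsum_reindex_bij_witness[of _ "\<lambda>(k, i). (i, k - i)" "\<lambda>(m, n). (m + n, m)"]) auto
  also have "\<dots> = (\<Sum>\<^sub>\<infinity>k. \<Sum>\<^sub>\<infinity>i\<in>{..k}. f (i, k - i))"
  proof (rule infsum_Sigma'_banach[symmetric])
    show "(\<lambda>(k, i). f (i, k - i)) summable_on (SIGMA k:UNIV. {..k})"
      using f by (subst summable_on_reindex_bij_witness[of _ "\<lambda>(m, n). (m + n, m)"
            "\<lambda>(k, i). (i, k - i)" UNIV f]) auto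
  qed
  also have "\<dots> = (\<Sum>\<^sub>\<infinity>k\<in>{0, 1}. ((-1) ^ k * real (1 choose k)) *\<^sub>R (A ^^ k) x)"
  proof (rule infsum_cong_neutral)
    fix k :: nat assume "k \<in> UNIV - {0, 1}"
    then show "(\<Sum>\<^sub>\<infinity>i\<in>{..k}. f (i, k - i)) = 0"
      by (simp add: diag binomial_eq_0)
  qed (auto simp: diag)
  finally show ?thesis
    by simp
qed

text \<open>The form of P at y + t P y is nonnegative for all real t. When the form at y is not
  positive, the linear coefficient, twice the squared norm of P y, must vanish.\<close>

lemma positive_on_kernel:
  assumes P: "positive_on H P" and y: "y \<in> H" "Re (cinner (P y) y) \<le> 0"
  shows "P y = 0"
proof -
  interpret P: bounded_operator H P
    by unfold_locales (use P H in \<open>auto simp: positive_on_def selfadjoint_on_def\<close>)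
  have sym: "inner (P u) v = inner u (P v)" if "u \<in> H" "v \<in> H" for u v
    using P that unfolding positive_on_def selfadjoint_on_def by (metis Re_cinner)
  define z where "z = P y"
  define c where "c = inner (P z) z"
  have z: "z \<in> H"
    by (simp add: z_def P.closed_op y)
  have c: "c \<ge> 0"
    using P z by (simp add: c_def positive_on_def Re_cinner)
  have ineq: "0 \<le> 2 * t * (norm z)\<^sup>2 + t\<^sup>2 * c" for t
  proof -
    have "0 \<le> inner (P (y + t *\<^sub>R z)) (y + t *\<^sub>R z)"
      using P y z by (simp add: positive_on_def Re_cinner hs_add[OF H] hs_scaleR[OF H])
    also have "\<dots> = inner (P y) y + t * inner (P y) z + t * inner (P z) y + t\<^sup>2 * c"
      using y z by (simp add: P.add P.scaleR hs_scaleR[OF H] inner_add c_def power2_eq_square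
          algebra_simps)
    also have "inner (P z) y = (norm z)\<^sup>2"
      by (simp add: sym z y power2_norm_eq_inner flip: z_def)
    also have "inner (P y) z = (norm z)\<^sup>2"
      by (simp add: power2_norm_eq_inner flip: z_def)
    finally show ?thesis
      using y by (simp add: Re_cinner)
  qed
  \<comment> \<open>Small enough for the linear term to dominate c t^2; the summand 1 covers
    \<open>c = 0\<close>.\<close>
  define t where "t = (norm z)\<^sup>2 / (c + 1)"
  have "0 \<le> t * (c * t - 2 * (norm z)\<^sup>2)"
    using ineq[of "- t"] by (simp add: algebra_simps power2_eq_square)
  moreover have "c * t \<le> (norm z)\<^sup>2"
    using c by (simp add: t_def field_simps)
  ultimately have "t * (norm z)\<^sup>2 \<le> 0"
    using c mult_left_mono[of "c * t" "(norm z)\<^sup>2" t] by (simp add: t_def algebra_simps)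
  then show ?thesis
    using c by (simp add: t_def z_def mult_le_0_iff divide_le_0_iff)
qed

text \<open>
  Any positive square root \<open>S\<close> of \<open>I - A\<close> commutes with \<open>A\<close>, hence with \<open>rt\<close>; then
  \<open>y = rt x - S x\<close> satisfies \<open>\<langle>rt y, y\<rangle> + \<langle>S y, y\<rangle> = 0\<close>, which forces \<open>rt y = S y = 0\<close>.
\<close>

lemma op_sqrt_eq: "op_sqrt H (\<lambda>x. x - A x) = restrict rt H"
  unfolding op_sqrt_def
proof (rule the_equality)
  show "restrict rt H \<in> extensional H \<and> positive_on H (restrict rt H) \<and>
      (\<forall>x\<in>H. restrict rt H (restrict rt H x) = x - A x)"
    using rt_positive rt_in rt_square hs_add[OF H] hs_scaleC[OF H]
    by (auto simp: positive_on_def selfadjoint_on_def bounded_op_on_def)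
next
  fix S assume S: "S \<in> extensional H \<and> positive_on H S \<and> (\<forall>x\<in>H. S (S x) = x - A x)"
  interpret S: bounded_operator H S
    by unfold_locales (use S H in \<open>auto simp: positive_on_def selfadjoint_on_def\<close>)
  interpret rt: bounded_operator H rt
    by unfold_locales (simp_all add: H rt_bounded)
  have "S (A x) = A (S x)" if x: "x \<in> H" for x
  proof -
    \<comment> \<open>A is the polynomial I - S^2 in S, hence commutes with it.\<close>
    have A_eq: "A u = u - S (S u)" if "u \<in> H" for u
      using S that by simp
    show ?thesis
      using x by (simp add: A_eq S.diff S.closed_op)
  qed
  then have comm: "S (rt x) = rt (S x)" if "x \<in> H" for x
    using rt_commute[OF S.bounded_operator_axioms _ that] by blast
  have "S x = rt x" if x: "x \<in> H" for x
  proof -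
    define y where "y = rt x - S x"
    have y: "y \<in> H"
      by (simp add: y_def x rt_in S.closed_op hs_diff[OF H])
    \<comment> \<open>By commutation (rt + S)(rt - S) = rt^2 - S^2, and both squares are I -
      A.\<close>
    have "rt y + S y = 0"
      using S x by (simp add: y_def rt.diff S.diff rt_in S.closed_op comm rt_square)
    then have "inner (rt y) y + inner (S y) y = 0"
      by (simp flip: inner_add_left)
    moreover have "inner (rt y) y \<ge> 0" "inner (S y) y \<ge> 0"
      using rt_positive S y by (auto simp: positive_on_def Re_cinner)
    ultimately have "rt y = 0" "S y = 0"
      using positive_on_kernel rt_positive S y by (auto simp: Re_cinner)
    then have "inner (rt y - S y) x = 0"
      by simp
    moreover have "cinner (rt y - S y) x = cinner y y"
    proof -
      have "cinner (rt y) x = cinner y (rt x)" "cinner (S y) x = cinner y (S x)"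
        using rt_positive S x y by (auto simp: positive_on_def selfadjoint_on_def)
      then show ?thesis
        by (simp add: cinner_diff_left cinner_diff_right y_def)
    qed
    ultimately have "inner y y = 0"
      by (metis Re_cinner)
    then show ?thesis
      by (simp add: y_def)
  qed
  with S show "S = restrict rt H"
    by (intro extensionalityI[of _ H]) auto
qed

end

section \<open>The defect operator\<close>

text \<open>Membership in H is carried through the induction because A is linear only on H.\<close>

lemma (in bounded_operator) image_span_subset:
  assumes "X \<subseteq> H" "x \<in> complex_vector.span X"
  shows "x \<in> H \<and> A x \<in> complex_vector.span (A ` X)"
  using assms(2)
proof (induction rule: complex_vector.span_induct)
  case base
  show ?case
    by (auto simp: complex_vector.subspace_def add scaleC zero hs_add[OF H] hs_scaleC[OF H]
        hs_zero[OF H] complex_vector.span_zero complex_vector.span_add complex_vector.span_scale)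
next
  case (step x)
  then show ?case
    using assms(1) by (auto intro: complex_vector.span_base)
qed

lemma (in bounded_operator) closure_span_subset:
  "X \<subseteq> H \<Longrightarrow> closure (complex_vector.span X) \<subseteq> H"
  using H by (intro closure_minimal complex_vector.span_minimal) (auto simp: hilbert_subspace_def)

lemma (in bounded_operator) image_closure_span_subset:
  assumes "X \<subseteq> H"
  shows "A ` closure (complex_vector.span X) \<subseteq> closure (complex_vector.span (A ` X))"
proof (rule image_closure_subset)
  show "continuous_on (closure (complex_vector.span X)) A"
    using closure_span_subset[OF assms] continuous continuous_on_subset by blast
  show "A ` complex_vector.span X \<subseteq> closure (complex_vector.span (A ` X))"
    using image_span_subset[OF assms] closure_subset by blast
qed simp

context selfadjoint_contraction
begin

abbreviation "D \<equiv> defect_op H A"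
abbreviation "\<DD> \<equiv> defect_space H A"

text \<open>The square root construction is applied to A^2, again a selfadjoint contraction.\<close>

lemma defect_op_properties:
  shows defect_positive: "positive_on H D"
    and defect_square: "x \<in> H \<Longrightarrow> D (D x) = x - A (A x)"
    and defect_commute: "x \<in> H \<Longrightarrow> A (D x) = D (A x)"
proof -
  have "bounded_op_on H (\<lambda>x. A (A x))"
    unfolding bounded_op_on_def using order_trans[OF contr contr]
    by (auto simp: add scaleC closed_op intro!: exI[of _ 1])
  then interpret sq: selfadjoint_contraction H "\<lambda>x. A (A x)"
    using order_trans[OF contr contr]
    by unfold_locales
      (auto simp: H selfadjoint_contraction_on_def selfadjoint_on_def sym closed_op)
  have D: "D = restrict sq.rt H"
    by (simp add: defect_op_def sq.op_sqrt_eq)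
  show "positive_on H D"
    using sq.rt_positive sq.rt_in hs_add[OF H] hs_scaleC[OF H]
    by (auto simp: D positive_on_def selfadjoint_on_def bounded_op_on_def)
  show "D (D x) = x - A (A x)" if "x \<in> H"
    using that by (simp add: D sq.rt_in sq.rt_square)
  show "A (D x) = D (A x)" if "x \<in> H"
    using that sq.rt_commute[OF bounded_operator_axioms _ that] by (simp add: D closed_op)
qed

sublocale D: bounded_operator H D
  by unfold_locales (use defect_positive H in \<open>auto simp: positive_on_def selfadjoint_on_def\<close>)

lemma defect_sym: "x \<in> H \<Longrightarrow> y \<in> H \<Longrightarrow> cinner (D x) y = cinner x (D y)"
  using defect_positive by (auto simp: positive_on_def selfadjoint_on_def)

lemma subspace_defect_range: "complex_vector.subspace (D ` H)"
  unfolding complex_vector.subspace_def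
proof (intro conjI ballI allI)
  show "0 \<in> D ` H"
    using D.zero hs_zero[OF H] by force
  show "x + y \<in> D ` H" if "x \<in> D ` H" "y \<in> D ` H" for x y
    using that by (auto simp: hs_add[OF H] simp flip: D.add)
  show "c *\<^sub>C x \<in> D ` H" if "x \<in> D ` H" for x c
    using that by (auto simp: hs_scaleC[OF H] simp flip: D.scaleC)
qed

lemma hilbert_subspace_defect_space: "hilbert_subspace \<DD>"
  unfolding defect_space_def by (rule hilbert_subspace_closure[OF subspace_defect_range])

lemma defect_space_subset: "\<DD> \<subseteq> H"
  unfolding defect_space_def by (intro closure_minimal hs_closed[OF H]) (auto simp: D.closed_op)

lemma defect_in_space: "x \<in> H \<Longrightarrow> D x \<in> \<DD>"
  unfolding defect_space_def using closure_subset[of "D ` H"] by auto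

lemma defect_space_invariant: "x \<in> \<DD> \<Longrightarrow> A x \<in> \<DD>"
proof -
  have "A ` \<DD> \<subseteq> \<DD>"
    unfolding defect_space_def
  proof (rule image_closure_subset)
    show "continuous_on (closure (D ` H)) A"
      using defect_space_subset by (intro continuous_on_subset[OF continuous]) (simp add: defect_space_def)
    show "A ` D ` H \<subseteq> closure (D ` H)"
      using closure_subset[of "D ` H"] by (auto simp: defect_commute closed_op)
  qed simp
  then show "x \<in> \<DD> \<Longrightarrow> A x \<in> \<DD>"
    by blast
qed

end

section \<open>Orthogonal projections\<close>

lemma orth_proj_exists:
  assumes N: "hilbert_subspace N"
  shows "\<exists>y\<in>N. \<forall>m\<in>N. cinner (x - y) m = 0"
proof -
  define q where "q = Inf ((\<lambda>y. (norm (x - y))\<^sup>2) ` N)"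
  have bdd: "bdd_below ((\<lambda>y. (norm (x - y))\<^sup>2) ` N)"
    by (rule bdd_belowI2[of _ 0]) simp
  have q_le: "q \<le> (norm (x - y))\<^sup>2" if "y \<in> N" for y
    unfolding q_def using that by (intro cInf_lower bdd) auto
  have "\<exists>y\<in>N. (norm (x - y))\<^sup>2 < q + 1 / Suc n" for n
  proof -
    have "(\<lambda>y. (norm (x - y))\<^sup>2) ` N \<noteq> {}"
      using hs_zero[OF N] by auto
    then have "\<exists>v\<in>(\<lambda>y. (norm (x - y))\<^sup>2) ` N. v < q + 1 / Suc n"
      unfolding q_def using bdd by (subst cInf_less_iff[symmetric]) auto
    then show ?thesis
      by auto
  qed
  then obtain y where y: "\<And>n. y n \<in> N" "\<And>n. (norm (x - y n))\<^sup>2 < q + 1 / Suc n"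
    by metis
  \<comment> \<open>Parallelogram law: the midpoint of y m and y n lies in N, so its squared
    distance to x is at least q.\<close>
  have dist: "(norm (y m - y n))\<^sup>2 \<le> 2 / Suc m + 2 / Suc n" for m n
  proof -
    have "(norm (y m - y n))\<^sup>2 + 4 * (norm (x - (1/2) *\<^sub>R (y m + y n)))\<^sup>2
        = 2 * (norm (x - y m))\<^sup>2 + 2 * (norm (x - y n))\<^sup>2"
      unfolding power2_norm_eq_inner
      by (simp add: inner_diff_left inner_diff_right inner_add_left inner_add_right inner_commute
          algebra_simps)
    moreover have "q \<le> (norm (x - (1/2) *\<^sub>R (y m + y n)))\<^sup>2"
      by (intro q_le hs_scaleR[OF N] hs_add[OF N] y)
    ultimately show ?thesis
      using y(2)[of m] y(2)[of n] by simp
  qed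
  have "Cauchy y"
  proof (rule metric_CauchyI)
    fix e :: real assume e: "e > 0"
    then obtain K where K: "4 / e\<^sup>2 < real (Suc K)"
      using reals_Archimedean2[of "4 / e\<^sup>2"] by (metis lessI less_trans of_nat_less_iff)
    show "\<exists>K. \<forall>m\<ge>K. \<forall>n\<ge>K. dist (y m) (y n) < e"
    proof (intro exI allI impI)
      fix m n assume mn: "K \<le> m" "K \<le> n"
      have "(norm (y m - y n))\<^sup>2 \<le> 2 / Suc m + 2 / Suc n"
        by (rule dist)
      also have "\<dots> \<le> 2 / Suc K + 2 / Suc K"
        using mn by (intro add_mono divide_left_mono) auto
      also have "\<dots> = 4 / Suc K"
        by (simp flip: add_divide_distrib)
      also have "\<dots> < e\<^sup>2"
        using K e by (simp add: field_simps)
      finally show "dist (y m) (y n) < e"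
        using e by (simp add: dist_norm power_less_imp_less_base)
    qed
  qed
  then obtain l where l: "l \<in> N" "y \<longlonglongrightarrow> l"
    using hs_complete[OF N] y(1) unfolding complete_def by blast
  have l_min: "(norm (x - l))\<^sup>2 \<le> q"
  proof (rule LIMSEQ_le)
    show "(\<lambda>n. (norm (x - y n))\<^sup>2) \<longlonglongrightarrow> (norm (x - l))\<^sup>2"
      by (intro tendsto_intros l)
    show "(\<lambda>n. q + 1 / Suc n) \<longlonglongrightarrow> q"
      using tendsto_add[OF tendsto_const LIMSEQ_inverse_real_of_nat, of q]
      by (simp add: inverse_eq_divide)
  qed (use y(2) less_imp_le in blast)
  have "inner (x - l) m = 0" if m: "m \<in> N" for m
  proof -
    define s where "s = inner (x - l) m"
    \<comment> \<open>Nearly the minimizing step along m; the summand 1 keeps the denominator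
      positive for \<open>m = 0\<close>.\<close>
    define t where "t = s / (1 + (norm m)\<^sup>2)"
    have pos: "1 + (norm m)\<^sup>2 > 0"
      by (smt (verit) zero_le_power2)
    have "(norm (x - l))\<^sup>2 \<le> (norm (x - (l + t *\<^sub>R m)))\<^sup>2"
      by (intro order_trans[OF l_min] q_le hs_add[OF N] hs_scaleR[OF N] l m)
    also have "\<dots> = (norm (x - l))\<^sup>2 - 2 * t * s + t\<^sup>2 * (norm m)\<^sup>2"
      unfolding power2_norm_eq_inner s_def
      by (simp add: inner_diff_left inner_diff_right inner_add_left inner_add_right inner_commute
          algebra_simps power2_eq_square)
    finally have "2 * t * s \<le> t\<^sup>2 * (norm m)\<^sup>2"
      by simp
    also have "\<dots> \<le> t * (t * (1 + (norm m)\<^sup>2))"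
      by (simp add: power2_eq_square algebra_simps)
    also have "t * (1 + (norm m)\<^sup>2) = s"
      using pos by (simp add: t_def)
    finally have "t * s \<le> 0"
      by (simp add: mult.commute)
    then have "s * s \<le> 0"
      using pos by (simp add: t_def divide_le_0_iff)
    then show ?thesis
      by (simp add: s_def flip: power2_eq_square)
  qed
  \<comment> \<open>Real orthogonality to both m and \<i> m is complex orthogonality.\<close>
  then have "\<forall>m\<in>N. cinner (x - l) m = 0"
    using hs_scaleC[OF N] by (simp add: cinner_eq_Complex complex_eq_iff)
  with l show ?thesis
    by blast
qed

lemma orthogonal_eq_zero: "x \<in> N \<Longrightarrow> (\<And>m. m \<in> N \<Longrightarrow> cinner x m = 0) \<Longrightarrow> x = 0"
  using cinner_self[of x] by (metis norm_eq_zero of_real_eq_0_iff power_eq_0_iff)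

lemma orth_proj:
  assumes N: "hilbert_subspace N"
  shows orth_proj_in: "orth_proj N x \<in> N"
    and cinner_orth_proj: "m \<in> N \<Longrightarrow> cinner (orth_proj N x) m = cinner x m"
    and orth_proj_ident: "x \<in> N \<Longrightarrow> orth_proj N x = x"
proof -
  have unique: "y = y'" if "y \<in> N \<and> (\<forall>m\<in>N. cinner (x - y) m = 0)"
      "y' \<in> N \<and> (\<forall>m\<in>N. cinner (x - y') m = 0)" for x y y'
  proof -
    have "y - y' = 0"
      using that by (intro orthogonal_eq_zero[of _ N]) (auto simp: hs_diff[OF N] cinner_diff_left)
    then show ?thesis
      by simp
  qed
  have P: "orth_proj N x \<in> N \<and> (\<forall>m\<in>N. cinner (x - orth_proj N x) m = 0)" for x
    unfolding orth_proj_def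
    by (rule theI', use orth_proj_exists[OF N] unique in blast)
  show "orth_proj N x \<in> N"
    using P by blast
  show "cinner (orth_proj N x) m = cinner x m" if "m \<in> N"
    using P[of x] that by (auto simp: cinner_diff_left)
  show "orth_proj N x = x" if "x \<in> N"
    by (rule unique[OF P]) (simp add: that)
qed

section \<open>Passive selfadjoint systems\<close>

locale passive_system =
  fixes T :: "'m::separable_hilbert_space \<times> 'k::separable_hilbert_space \<Rightarrow> 'm \<times> 'k"
    and M :: "'m set" and K :: "'k set"
  assumes is_system: "passive_selfadjoint_system T M K"
begin

lemma subspaces: "hilbert_subspace M" "hilbert_subspace K"
  using is_system by (auto simp: passive_selfadjoint_system_def)

sublocale T: selfadjoint_contraction "M \<times> K" T
  by unfold_locales
    (use is_system in \<open>auto simp: passive_selfadjoint_system_def hilbert_subspace_Times\<close>)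

lemma zero_in [simp]: "0 \<in> M" "0 \<in> K"
  using subspaces by (auto simp: hs_zero)

lemma T_split:
  assumes "m \<in> M" "k \<in> K"
  shows "T (m, k) = (blk_D T m + blk_C T k, blk_Cadj T m + blk_F T k)"
  using T.add[of "(m, 0)" "(0, k)"] assms
  by (simp add: blk_D_def blk_C_def blk_Cadj_def blk_F_def prod_eq_iff)

lemma Cadj_in: "m \<in> M \<Longrightarrow> blk_Cadj T m \<in> K"
  using T.closed_op[of "(m, 0)"] by (auto simp: blk_Cadj_def mem_Times_iff)

sublocale F: selfadjoint_contraction K "blk_F T"
proof
  have K: "(0, k) \<in> M \<times> K" if "k \<in> K" for k
    using that by simp
  have F_in: "blk_F T k \<in> K" if "k \<in> K" for k
    using T.closed_op[OF K[OF that]] by (auto simp: blk_F_def mem_Times_iff)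
  have norm: "norm (blk_F T k) \<le> norm k" if "k \<in> K" for k
  proof -
    have "norm (blk_F T k) \<le> norm (T (0, k))"
      unfolding blk_F_def by (metis norm_snd_le prod.collapse)
    also have "\<dots> \<le> norm k"
      using T.contr[OF K[OF that]] by (simp add: norm_Pair)
    finally show ?thesis .
  qed
  have add: "blk_F T (k + l) = blk_F T k + blk_F T l" if "k \<in> K" "l \<in> K" for k l
    using T.add[OF K K, OF that] by (simp add: blk_F_def)
  have scale: "blk_F T (c *\<^sub>C k) = c *\<^sub>C blk_F T k" if "k \<in> K" for c k
    using T.scaleC[OF K, OF that, of c] by (simp add: blk_F_def scaleC_prod_def)
  have sym: "cinner (blk_F T k) l = cinner k (blk_F T l)" if "k \<in> K" "l \<in> K" for k l
    using T.sym[OF K K, OF that] by (simp add: blk_F_def cinner_prod_def)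
  show "selfadjoint_contraction_on K (blk_F T)"
    unfolding selfadjoint_contraction_on_def selfadjoint_on_def bounded_op_on_def
    using F_in norm add scale sym by (auto intro: exI[of _ 1])
qed (rule subspaces)

section \<open>The transfer function at a point of the cut plane\<close>

context
  fixes z :: complex
  assumes z: "z \<in> cut_plane"
begin

text \<open>The internal state answering the input m: it makes the second component of (I - z T) (m,
  state m) vanish. The factor z of the transfer function is absorbed into it.\<close>

definition state :: "'m \<Rightarrow> 'k" where
  "state m = z *\<^sub>C inv_into K (\<lambda>k. k - z *\<^sub>C blk_F T k) (blk_Cadj T m)"

lemma state_in: "m \<in> M \<Longrightarrow> state m \<in> K"
  unfolding state_def
  by (intro hs_scaleC[OF subspaces(2)] inv_op_in[OF F.pencil_invertible[OF z]] Cadj_in)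

lemma bounded_operator_state:
  obtains b where "b \<ge> 0" "\<And>m. m \<in> M \<Longrightarrow> norm (state m) \<le> b * norm m"
    "\<And>m m'. m \<in> M \<Longrightarrow> m' \<in> M \<Longrightarrow> state (m + m') = state m + state m'"
    "\<And>c m. m \<in> M \<Longrightarrow> state (c *\<^sub>C m) = c *\<^sub>C state m"
proof -
  interpret R: bounded_operator K "inv_into K (\<lambda>k. k - z *\<^sub>C blk_F T k)"
    using F.pencil_invertible[OF z] subspaces by unfold_locales (auto simp: invertible_on_def)
  obtain b where b: "b > 0"
    "\<And>k. k \<in> K \<Longrightarrow> norm (inv_into K (\<lambda>k. k - z *\<^sub>C blk_F T k) k) \<le> b * norm k"
    using R.bound by blast
  have Cadj_norm: "norm (blk_Cadj T m) \<le> norm m" if "m \<in> M" for m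
  proof -
    have "norm (blk_Cadj T m) \<le> norm (T (m, 0))"
      unfolding blk_Cadj_def by (metis norm_snd_le prod.collapse)
    also have "\<dots> \<le> norm m"
      using T.contr[of "(m, 0)"] that by (simp add: norm_Pair)
    finally show ?thesis .
  qed
  have Cadj_add: "blk_Cadj T (m + m') = blk_Cadj T m + blk_Cadj T m'"
    if "m \<in> M" "m' \<in> M" for m m'
    using T.add[of "(m, 0)" "(m', 0)"] that by (simp add: blk_Cadj_def)
  have Cadj_scale: "blk_Cadj T (c *\<^sub>C m) = c *\<^sub>C blk_Cadj T m" if "m \<in> M" for c m
    using T.scaleC[of "(m, 0)" c] that by (simp add: blk_Cadj_def scaleC_prod_def)
  show thesis
  proof
    show "0 \<le> cmod z * b"
      using b by simp
    show "norm (state m) \<le> cmod z * b * norm m" if "m \<in> M" for m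
    proof -
      have "norm (state m) \<le> cmod z * (b * norm (blk_Cadj T m))"
        unfolding state_def norm_scaleC by (intro mult_left_mono b Cadj_in that) auto
      also have "\<dots> \<le> cmod z * (b * norm m)"
        using b Cadj_norm[OF that] by (intro mult_left_mono) auto
      finally show ?thesis
        by (simp add: mult.assoc)
    qed
    show "state (m + m') = state m + state m'" if "m \<in> M" "m' \<in> M" for m m'
      using that by (simp add: state_def Cadj_add R.add Cadj_in scaleC_add_right)
    show "state (c *\<^sub>C m) = c *\<^sub>C state m" if "m \<in> M" for c m
      using that by (simp add: state_def Cadj_scale R.scaleC Cadj_in scaleC_scaleC mult.commute)
  qed
qed

lemma state_eq:
  assumes "m \<in> M"
  shows "state m - z *\<^sub>C blk_F T (state m) = z *\<^sub>C blk_Cadj T m"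
proof -
  define k where "k = inv_into K (\<lambda>k. k - z *\<^sub>C blk_F T k) (blk_Cadj T m)"
  have k: "k \<in> K" "k - z *\<^sub>C blk_F T k = blk_Cadj T m"
    using inv_op_in[OF F.pencil_invertible[OF z]] op_inv_op[OF F.pencil_invertible[OF z]]
      Cadj_in[OF assms] by (auto simp: k_def)
  then have "z *\<^sub>C blk_Cadj T m = z *\<^sub>C k - z *\<^sub>C blk_F T (z *\<^sub>C k)"
    by (metis F.scaleC complex_vector.scale_right_diff_distrib)
  then show ?thesis
    by (simp add: state_def flip: k_def)
qed

lemma transfer_eq_fst:
  assumes "m \<in> M"
  shows "transfer_function T K z m = fst (T (m, state m))"
proof -
  define k where "k = inv_into K (\<lambda>k. k - z *\<^sub>C blk_F T k) (blk_Cadj T m)"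
  have "k \<in> K"
    unfolding k_def by (intro inv_op_in[OF F.pencil_invertible[OF z]] Cadj_in assms)
  then have "blk_C T (z *\<^sub>C k) = z *\<^sub>C blk_C T k"
    using T.scaleC[of "(0, k)" z] by (simp add: blk_C_def scaleC_prod_def)
  then show ?thesis
    using assms state_in by (simp add: T_split transfer_function_def state_def k_def)
qed

text \<open>Vector form of the Schur complement, which makes \<open>(m, state m)\<close> the
  resolvent of \<open>T\<close> at a vector of M.\<close>

lemma pencil_state:
  assumes "m \<in> M"
  shows "(m, state m) - z *\<^sub>C T (m, state m) = (m - z *\<^sub>C transfer_function T K z m, 0)"
proof -
  have "snd (T (m, state m)) = blk_Cadj T m + blk_F T (state m)"
    by (simp add: T_split assms state_in)
  then show ?thesis
    using state_eq[OF assms] assms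
    by (simp add: prod_eq_iff scaleC_prod_def transfer_eq_fst scaleC_add_right algebra_simps)
qed

lemma bounded_transfer: "bounded_op_on M (transfer_function T K z)"
proof -
  obtain b where b: "b \<ge> 0" "\<And>m. m \<in> M \<Longrightarrow> norm (state m) \<le> b * norm m"
    "\<And>m m'. m \<in> M \<Longrightarrow> m' \<in> M \<Longrightarrow> state (m + m') = state m + state m'"
    "\<And>c m. m \<in> M \<Longrightarrow> state (c *\<^sub>C m) = c *\<^sub>C state m"
    using bounded_operator_state by blast
  show ?thesis
    unfolding bounded_op_on_def
  proof (intro conjI ballI allI)
    show "transfer_function T K z \<in> M \<rightarrow> M"
      using T.closed_op state_in by (auto simp: transfer_eq_fst mem_Times_iff)
    show "transfer_function T K z (m + m') = transfer_function T K z m + transfer_function T K z m'"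
      if "m \<in> M" "m' \<in> M" for m m'
      using that T.add[of "(m, state m)" "(m', state m')"]
      by (simp add: transfer_eq_fst b hs_add[OF subspaces(1)] state_in)
    show "transfer_function T K z (c *\<^sub>C m) = c *\<^sub>C transfer_function T K z m" if "m \<in> M" for c m
      using that T.scaleC[of "(m, state m)" c]
      by (simp add: transfer_eq_fst b hs_scaleC[OF subspaces(1)] state_in scaleC_prod_def)
    have "norm (transfer_function T K z m) \<le> (1 + b) * norm m" if "m \<in> M" for m
    proof -
      have "norm (transfer_function T K z m) \<le> norm (T (m, state m))"
        unfolding transfer_eq_fst[OF that] by (metis norm_fst_le prod.collapse)
      also have "\<dots> \<le> norm (m, state m)"
        using that state_in by (intro T.contr) auto
      also have "\<dots> \<le> norm m + norm (state m)"
        by (simp add: norm_Pair sqrt_sum_squares_le_sum)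
      finally show ?thesis
        using b(2)[OF that] by (simp add: algebra_simps)
    qed
    then show "\<exists>b. \<forall>m\<in>M. norm (transfer_function T K z m) \<le> b * norm m"
      by blast
  qed
qed

abbreviation "resolvent \<equiv> inv_into (M \<times> K) (\<lambda>x. x - z *\<^sub>C T x)"

text \<open>
  \<open>I - z \<Omega>(z)\<close> is the Schur complement of \<open>I - z F\<close> in \<open>I - z T\<close>, so its inverse is the
  compression of \<open>resolvent\<close> to \<open>M\<close>.
\<close>

lemma resolvent_eq_state:
  assumes "m \<in> M"
  shows "resolvent (m, 0) = (fst (resolvent (m, 0)), state (fst (resolvent (m, 0))))"
    and "fst (resolvent (m, 0)) \<in> M"
    and "fst (resolvent (m, 0)) - z *\<^sub>C transfer_function T K z (fst (resolvent (m, 0))) = m"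
proof -
  obtain n k where nk: "resolvent (m, 0) = (n, k)"
    by (cases "resolvent (m, 0)")
  have in_H: "(m, 0) \<in> M \<times> K"
    using assms by simp
  have n: "n \<in> M" "k \<in> K"
    using inv_op_in[OF T.pencil_invertible[OF z] in_H] by (auto simp: nk)
  have eq: "(n, k) - z *\<^sub>C T (n, k) = (m, 0)"
    using op_inv_op[OF T.pencil_invertible[OF z] in_H] by (simp add: nk)
  then have "k - z *\<^sub>C blk_F T k = z *\<^sub>C blk_Cadj T n"
    using n by (simp add: T_split scaleC_prod_def scaleC_add_right algebra_simps)
  then have "k - z *\<^sub>C blk_F T k = state n - z *\<^sub>C blk_F T (state n)"
    using state_eq[OF n(1)] by simp
  then have "(k - state n) - (z *\<^sub>C blk_F T k - z *\<^sub>C blk_F T (state n)) = 0"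
    by (simp add: algebra_simps)
  then have diff: "(k - state n) - z *\<^sub>C blk_F T (k - state n) = 0"
    using n state_in by (simp only: F.diff complex_vector.scale_right_diff_distrib)
  have "k - state n = 0"
  proof -
    \<comment> \<open>Both \<open>k - state n\<close> and 0 are mapped to 0 by the injective
      pencil.\<close>
    have "inv_into K (\<lambda>k. k - z *\<^sub>C blk_F T k) 0 = x" if "x \<in> K" "x - z *\<^sub>C blk_F T x = 0" for x
      by (rule inv_op_eq[OF F.pencil_invertible[OF z] that])
    from this[of "k - state n"] this[of 0] show ?thesis
      using diff n state_in by (simp add: F.zero hs_diff[OF subspaces(2)])
  qed
  then have k: "k = state n"
    by simp
  then show "resolvent (m, 0) = (fst (resolvent (m, 0)), state (fst (resolvent (m, 0))))"
    by (simp add: nk)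
  show "fst (resolvent (m, 0)) \<in> M"
    using n by (simp add: nk)
  show "fst (resolvent (m, 0)) - z *\<^sub>C transfer_function T K z (fst (resolvent (m, 0))) = m"
    using eq pencil_state[OF n(1)] by (simp add: nk k)
qed

text \<open>The inverse is exhibited as the compressed resolvent of \<open>T\<close>, from which it
  inherits linearity and a bound.\<close>

lemma transfer_pencil_invertible: "invertible_on M (\<lambda>m. m - z *\<^sub>C transfer_function T K z m)"
proof -
  let ?Q = "\<lambda>m. m - z *\<^sub>C transfer_function T K z m"
  interpret Omega: bounded_operator M "transfer_function T K z"
    by unfold_locales (simp_all add: subspaces bounded_transfer)
  interpret R: bounded_operator "M \<times> K" resolvent
    using T.pencil_invertible[OF z] T.H by unfold_locales (auto simp: invertible_on_def)
  have Q: "bounded_op_on M ?Q"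
    using Omega.bounded_operator_affine[of 1 "- z"] by simp
  have inj: "m = n" if "m \<in> M" "n \<in> M" "?Q m = ?Q n" for m n
  proof -
    have "resolvent (?Q m, 0) = (m, state m)" "resolvent (?Q n, 0) = (n, state n)"
      using that pencil_state state_in by (auto intro!: inv_op_eq[OF T.pencil_invertible[OF z]])
    then show ?thesis
      using that(3) by (metis prod.inject)
  qed
  have inv: "inv_into M ?Q m = fst (resolvent (m, 0))" if "m \<in> M" for m
    using resolvent_eq_state(2,3)[OF that] inj by (intro inv_into_f_eq inj_onI) auto
  obtain b where b: "b > 0" "\<And>x. x \<in> M \<times> K \<Longrightarrow> norm (resolvent x) \<le> b * norm x"
    using R.bound by blast
  have "bounded_op_on M (inv_into M ?Q)"
    unfolding bounded_op_on_def
  proof (intro conjI ballI allI)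
    show "inv_into M ?Q (m + n) = inv_into M ?Q m + inv_into M ?Q n" if "m \<in> M" "n \<in> M" for m n
      using that R.add[of "(m, 0)" "(n, 0)"] by (simp add: inv hs_add[OF subspaces(1)])
    show "inv_into M ?Q (c *\<^sub>C m) = c *\<^sub>C inv_into M ?Q m" if "m \<in> M" for c m
      using that R.scaleC[of "(m, 0)" c] by (simp add: inv hs_scaleC[OF subspaces(1)] scaleC_prod_def)
    have "norm (inv_into M ?Q m) \<le> b * norm m" if "m \<in> M" for m
    proof -
      have "norm (inv_into M ?Q m) \<le> norm (resolvent (m, 0))"
        using norm_fst_le[of "fst (resolvent (m, 0))" "snd (resolvent (m, 0))"]
        unfolding inv[OF that] by simp
      also have "\<dots> \<le> b * norm (m, 0 :: 'k)"
        using that by (intro b) auto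
      finally show ?thesis
        by (simp add: norm_Pair)
    qed
    then show "\<exists>b. \<forall>m\<in>M. norm (inv_into M ?Q m) \<le> b * norm m"
      by blast
  qed (auto simp: inv resolvent_eq_state(2))
  moreover have "bij_betw ?Q M M"
  proof -
    have "inj_on ?Q M"
      using inj by (rule inj_onI)
    moreover have "?Q ` M \<subseteq> M"
      using Q by (auto simp: bounded_op_on_def)
    moreover have "m \<in> ?Q ` M" if "m \<in> M" for m
      by (rule image_eqI[of _ ?Q, OF resolvent_eq_state(3)[OF that, symmetric]
            resolvent_eq_state(2)[OF that]])
    ultimately show ?thesis
      unfolding bij_betw_def by blast
  qed
  ultimately show ?thesis
    using Q by (simp add: invertible_on_def)
qed

text \<open>Both sides are the first component of z I - T at one vector, since
  \<open>resolvent (m, 0)\<close> is \<open>(n, state n)\<close>.\<close>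

lemma transfer_cayley:
  assumes "m \<in> M"
  defines "n \<equiv> inv_into M (\<lambda>m. m - z *\<^sub>C transfer_function T K z m) m"
  shows "z *\<^sub>C n - transfer_function T K z n
    = fst (z *\<^sub>C resolvent (m, 0) - T (resolvent (m, 0)))"
proof -
  have n: "n = fst (resolvent (m, 0))"
    unfolding n_def using resolvent_eq_state(2,3)[OF assms(1)]
    by (intro inv_op_eq[OF transfer_pencil_invertible])
  have "n \<in> M" "resolvent (m, 0) = (n, state n)"
    unfolding n by (rule resolvent_eq_state(2,1)[OF assms(1)])+
  then show ?thesis
    by (simp add: transfer_eq_fst scaleC_prod_def)
qed

end

text \<open>Translates minimality, a statement about F and \<open>C\<^sup>*\<close> on K, into
  cyclicity of M under the whole of \<open>T\<close>, which is the form that passes to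
  \<open>T_Phi\<close>. The closed span L is invariant under \<open>T\<close> and contains M, so
  second components of its vectors stay in L; this produces the generators of K one power of F at a
  time.\<close>

lemma minimal_span:
  assumes "minimal_system T M K"
  shows "closure (complex_vector.span {(T ^^ n) (m, 0) |n m. m \<in> M}) = M \<times> K"
proof -
  define X where "X = {(T ^^ n) (m, 0 :: 'k) |n m. m \<in> M}"
  define L where "L = closure (complex_vector.span X)"
  have X: "X \<subseteq> M \<times> K"
  proof
    fix x assume "x \<in> X"
    then obtain n m where "x = (T ^^ n) (m, 0)" "m \<in> M"
      by (auto simp: X_def)
    then show "x \<in> M \<times> K"
      using T.funpow_in[of "(m, 0)" n] by simp
  qed
  have L_sub: "L \<subseteq> M \<times> K"
    unfolding L_def by (rule T.closure_span_subset[OF X])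
  have L: "hilbert_subspace L"
    unfolding L_def by (intro hilbert_subspace_closure) simp
  have "T ` X \<subseteq> X"
  proof (rule image_subsetI)
    fix x assume "x \<in> X"
    then obtain n m where "x = (T ^^ n) (m, 0)" "m \<in> M"
      by (auto simp: X_def)
    then show "T x \<in> X"
      unfolding X_def by (auto intro!: exI[of _ "Suc n"] exI[of _ m])
  qed
  then have T_L: "T x \<in> L" if "x \<in> L" for x
    using T.image_closure_span_subset[OF X] that
      closure_mono[OF complex_vector.span_mono[of "T ` X" X]] unfolding L_def by blast
  have M_L: "(m, 0) \<in> L" if "m \<in> M" for m
  proof -
    have "(m, 0) \<in> X"
      unfolding X_def using that by (auto intro!: exI[of _ 0] exI[of _ m])
    then show ?thesis
      unfolding L_def using complex_vector.span_base closure_subset[THEN subsetD] by metis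
  qed
  have snd_L: "(0, k) \<in> L" if "(m, k) \<in> L" for m k
  proof -
    have "(m, k) - (m, 0) \<in> L"
      using that L_sub by (intro hs_diff[OF L] M_L) auto
    then show ?thesis
      by simp
  qed
  have gen: "(0, (blk_F T ^^ n) (blk_Cadj T m)) \<in> L" if "m \<in> M" for n m
  proof (induction n)
    case 0
    have "T (m, 0) \<in> L"
      by (intro T_L M_L that)
    then show ?case
      using snd_L[of "fst (T (m, 0))"] by (simp add: blk_Cadj_def)
  next
    case (Suc n)
    define k where "k = (blk_F T ^^ n) (blk_Cadj T m)"
    have "T (0, k) \<in> L"
      using Suc by (simp add: T_L k_def)
    then have "(0, blk_F T k) \<in> L"
      using snd_L[of "fst (T (0, k))"] by (simp add: blk_F_def)
    then show ?case
      by (simp add: k_def)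
  qed
  define K' where "K' = {k. (0, k) \<in> L}"
  have "closed K'"
  proof -
    have "closed ((\<lambda>k. (0 :: 'm, k)) -` L)"
      by (intro closed_vimage hs_closed[OF L] continuous_intros)
    then show ?thesis
      by (simp add: K'_def vimage_def)
  qed
  moreover have "complex_vector.subspace K'"
    unfolding complex_vector.subspace_def K'_def
  proof (intro conjI ballI allI CollectI)
    show "(0, 0) \<in> L"
      using hs_zero[OF L] by (simp add: zero_prod_def)
    show "(0, k + l) \<in> L" if "k \<in> {k. (0, k) \<in> L}" "l \<in> {k. (0, k) \<in> L}" for k l
      using hs_add[OF L, of "(0, k)" "(0, l)"] that by simp
    show "(0, c *\<^sub>C k) \<in> L" if "k \<in> {k. (0, k) \<in> L}" for c k
      using hs_scaleC[OF L, of "(0, k)" c] that by (simp add: scaleC_prod_def)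
  qed
  moreover have "{(blk_F T ^^ n) (blk_Cadj T m) |n m. m \<in> M} \<subseteq> K'"
    using gen by (auto simp: K'_def)
  ultimately have "closure (complex_vector.span {(blk_F T ^^ n) (blk_Cadj T m) |n m. m \<in> M}) \<subseteq> K'"
    by (intro closure_minimal complex_vector.span_minimal)
  then have K: "K \<subseteq> K'"
    using assms by (simp add: minimal_system_def)
  have "(m, k) \<in> L" if "m \<in> M" "k \<in> K" for m k
  proof -
    have "(m, 0) + (0, k) \<in> L"
      using that K by (intro hs_add[OF L] M_L) (auto simp: K'_def)
    then show ?thesis
      by simp
  qed
  then have "L = M \<times> K"
    using L_sub by auto
  then show ?thesis
    by (simp add: L_def X_def)
qed

end

section \<open>The block operator on the defect space\<close>

text \<open>One computation serves both settings: the first summand of M x K and a subspace N of H.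
  P is the adjoint of the isometry J, and its linearity and contractivity are deduced from
  this.\<close>

locale compression = selfadjoint_contraction H A
  for H :: "'h::separable_hilbert_space set" and A +
  fixes M :: "'m::separable_hilbert_space set" and P :: "'h \<Rightarrow> 'm" and J :: "'m \<Rightarrow> 'h"
  assumes M: "hilbert_subspace M"
    and J_in: "m \<in> M \<Longrightarrow> J m \<in> H"
    and J_add: "m \<in> M \<Longrightarrow> n \<in> M \<Longrightarrow> J (m + n) = J m + J n"
    and J_scaleC: "m \<in> M \<Longrightarrow> J (c *\<^sub>C m) = c *\<^sub>C J m"
    and P_in: "x \<in> H \<Longrightarrow> P x \<in> M"
    and cinner_P: "x \<in> H \<Longrightarrow> m \<in> M \<Longrightarrow> cinner (P x) m = cinner x (J m)"
    and P_J: "m \<in> M \<Longrightarrow> P (J m) = m"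
begin

lemma eq_in_M:
  assumes "m \<in> M" "n \<in> M" "\<And>l. l \<in> M \<Longrightarrow> cinner m l = cinner n l"
  shows "m = n"
proof -
  have "m - n = 0"
    using assms by (intro orthogonal_eq_zero[of _ M]) (auto simp: hs_diff[OF M] cinner_diff_left)
  then show ?thesis
    by simp
qed

lemma P_add: "x \<in> H \<Longrightarrow> y \<in> H \<Longrightarrow> P (x + y) = P x + P y"
  by (rule eq_in_M) (auto simp: P_in hs_add[OF M] hs_add[OF H] cinner_P cinner_add_left)

lemma P_scaleC: "x \<in> H \<Longrightarrow> P (c *\<^sub>C x) = c *\<^sub>C P x"
  by (rule eq_in_M) (auto simp: P_in hs_scaleC[OF M] hs_scaleC[OF H] cinner_P cinner_scaleC_left)

lemma P_minus: "x \<in> H \<Longrightarrow> P (- x) = - P x"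
  using P_scaleC[of x "-1"] by simp

lemma P_diff: "x \<in> H \<Longrightarrow> y \<in> H \<Longrightarrow> P (x - y) = P x - P y"
  using P_add[of x "- y"] by (simp add: P_minus hs_minus[OF H])

lemma J_zero: "J 0 = 0"
  using J_scaleC[of 0 0] hs_zero[OF M] by simp

lemma P_zero: "P 0 = 0"
  using P_J[of 0] hs_zero[OF M] by (simp add: J_zero)

lemma cinner_P_right: "x \<in> H \<Longrightarrow> m \<in> M \<Longrightarrow> cinner m (P x) = cinner (J m) x"
  by (metis cinner_P cinner_commute)

lemma norm_J: "m \<in> M \<Longrightarrow> norm (J m) = norm m"
proof -
  assume m: "m \<in> M"
  have "cinner (J m) (J m) = cinner m m"
    using cinner_P[OF J_in[OF m] m] by (simp add: P_J m)
  then have "inner (J m) (J m) = inner m m"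
    by (metis Re_cinner)
  then show ?thesis
    by (simp add: norm_eq_sqrt_inner)
qed

lemma norm_P: "x \<in> H \<Longrightarrow> norm (P x) \<le> norm x"
proof -
  assume x: "x \<in> H"
  have "(norm (P x))\<^sup>2 = inner x (J (P x))"
    using cinner_P[OF x P_in[OF x]] by (metis Re_cinner power2_norm_eq_inner)
  also have "\<dots> \<le> norm x * norm (P x)"
    using norm_cauchy_schwarz[of x "J (P x)"] by (simp add: norm_J P_in x)
  finally show ?thesis
    by (cases "P x = 0") (auto simp: power2_eq_square)
qed

abbreviation "A\<Phi> \<equiv> T_Phi P J H A"

lemma T_Phi_eq: "A\<Phi> (m, h) = (- P (A (J m)) + P (D h), D (J m) + A h)"
  by (simp add: T_Phi_def)

text \<open>
  \<open>A\<Phi>\<close> is the compression to \<open>M \<times> \<DD>\<close> of the unitary selfadjoint block operator with rows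
  \<open>(- A, D)\<close> and \<open>(D, A)\<close>; the cross terms of the squared norm cancel as \<open>A\<close> and \<open>D\<close> commute.
\<close>

lemma T_Phi_contraction:
  assumes m: "m \<in> M" and h: "h \<in> H"
  shows "norm (A\<Phi> (m, h)) \<le> norm (m, h)"
proof -
  have sym': "inner (A x) y = inner x (A y)" "inner (D x) y = inner x (D y)"
    if "x \<in> H" "y \<in> H" for x y
    using sym[OF that] defect_sym[OF that] by (metis Re_cinner)+
  have split: "(norm (A x))\<^sup>2 + (norm (D x))\<^sup>2 = (norm x)\<^sup>2" if "x \<in> H" for x
    using that
    by (simp add: power2_norm_eq_inner sym' closed_op D.closed_op defect_square inner_diff_right)
  let ?j = "J m"
  have j: "?j \<in> H"
    by (rule J_in[OF m])
  have "inner (A ?j) (D h) = inner (D ?j) (A h)"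
    using j h by (simp add: sym' closed_op D.closed_op defect_commute)
  then have cross: "(norm (D h - A ?j))\<^sup>2 + (norm (D ?j + A h))\<^sup>2 = (norm ?j)\<^sup>2 + (norm h)\<^sup>2"
    using split[OF j] split[OF h]
    by (simp add: power2_norm_eq_inner inner_add inner_diff inner_commute)
  have "fst (A\<Phi> (m, h)) = P (D h - A ?j)"
    using j h by (simp add: T_Phi_eq P_diff D.closed_op closed_op)
  then have "norm (fst (A\<Phi> (m, h))) \<le> norm (D h - A ?j)"
    using j h norm_P by (simp add: hs_diff[OF H] D.closed_op closed_op)
  then have "(norm (fst (A\<Phi> (m, h))))\<^sup>2 \<le> (norm (D h - A ?j))\<^sup>2"
    by (rule power_mono) simp
  moreover have snd: "snd (A\<Phi> (m, h)) = D ?j + A h"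
    by (simp add: T_Phi_eq)
  ultimately have "(norm (fst (A\<Phi> (m, h))))\<^sup>2 + (norm (snd (A\<Phi> (m, h))))\<^sup>2 \<le> (norm m)\<^sup>2 + (norm h)\<^sup>2"
    using cross unfolding norm_J[OF m] snd by linarith
  then show ?thesis
    by (simp add: norm_prod_def)
qed

lemma T_Phi_selfadjoint_contraction: "selfadjoint_contraction_on (M \<times> \<DD>) A\<Phi>"
proof -
  have h: "h \<in> H" if "h \<in> \<DD>" for h
    using that defect_space_subset by blast
  have "A\<Phi> x \<in> M \<times> \<DD>" if "x \<in> M \<times> \<DD>" for x
    using that h
    by (auto simp: T_Phi_eq hs_diff[OF M] P_in J_in closed_op D.closed_op defect_in_space
        defect_space_invariant intro!: hs_add[OF hilbert_subspace_defect_space])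
  moreover have "A\<Phi> (x + y) = A\<Phi> x + A\<Phi> y" if "x \<in> M \<times> \<DD>" "y \<in> M \<times> \<DD>" for x y
    using that h
    by (auto simp: T_Phi_eq P_add J_add J_in add D.add closed_op D.closed_op)
  moreover have "A\<Phi> (c *\<^sub>C x) = c *\<^sub>C A\<Phi> x" if "x \<in> M \<times> \<DD>" for c x
    using that h
    by (auto simp: T_Phi_eq scaleC_prod_def P_scaleC J_scaleC J_in scaleC D.scaleC closed_op
        D.closed_op scaleC_add_right complex_vector.scale_right_diff_distrib)
  moreover have "cinner (A\<Phi> x) y = cinner x (A\<Phi> y)" if "x \<in> M \<times> \<DD>" "y \<in> M \<times> \<DD>" for x y
    using that h
    by (auto simp: T_Phi_eq cinner_prod_def cinner_add_left cinner_add_right cinner_diff_left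
        cinner_diff_right cinner_P cinner_P_right sym defect_sym J_in closed_op D.closed_op)
  moreover have "norm (A\<Phi> x) \<le> norm x" if "x \<in> M \<times> \<DD>" for x
    using that T_Phi_contraction h by auto
  ultimately show ?thesis
    unfolding selfadjoint_contraction_on_def selfadjoint_on_def bounded_op_on_def
    by (auto intro!: exI[of _ 1])
qed

lemma T_Phi_passive_system: "passive_system A\<Phi> M \<DD>"
  by unfold_locales (simp add: passive_selfadjoint_system_def M hilbert_subspace_defect_space
      T_Phi_selfadjoint_contraction)

sublocale \<Phi>: passive_system A\<Phi> M \<DD>
  by (rule T_Phi_passive_system)

lemma T_Phi_blocks:
  shows "blk_F A\<Phi> h = A h" and "blk_Cadj A\<Phi> m = D (J m)"
    and "blk_C A\<Phi> h = P (D h)" and "blk_D A\<Phi> m = - P (A (J m))"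
  by (simp_all add: blk_F_def blk_Cadj_def blk_C_def blk_D_def T_Phi_eq J_zero P_zero zero D.zero)

text \<open>If x solves (I - z A) x = J m, then D x solves the equation that determines the state of
  \<open>A\<Phi>\<close>, and a second D turns it into (I - A^2) x.\<close>

lemma T_Phi_transfer:
  assumes z: "z \<in> cut_plane" and m: "m \<in> M"
  defines "x \<equiv> inv_into H (\<lambda>x. x - z *\<^sub>C A x) (J m)"
  shows "transfer_function A\<Phi> \<DD> z m = P (z *\<^sub>C x - A x)"
proof -
  have x: "x \<in> H" "x - z *\<^sub>C A x = J m"
    unfolding x_def
    using inv_op_in[OF pencil_invertible[OF z]] op_inv_op[OF pencil_invertible[OF z]] J_in[OF m]
    by auto
  have "D x - z *\<^sub>C A (D x) = D (J m)"
    unfolding x(2)[symmetric]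
    using x(1) by (simp add: D.diff D.scaleC defect_commute closed_op hs_scaleC[OF H])
  then have "inv_into \<DD> (\<lambda>h. h - z *\<^sub>C blk_F A\<Phi> h) (blk_Cadj A\<Phi> m) = D x"
    by (intro inv_op_eq[OF \<Phi>.F.pencil_invertible[OF z]])
      (auto simp: T_Phi_blocks defect_in_space x)
  then have "transfer_function A\<Phi> \<DD> z m = - P (A (J m)) + z *\<^sub>C P (D (D x))"
    by (simp add: transfer_function_def T_Phi_blocks)
  also have "\<dots> = P (- A (J m) + z *\<^sub>C (x - A (A x)))"
    using x J_in[OF m]
    by (simp add: defect_square P_diff P_add P_minus P_scaleC closed_op hs_diff[OF H] hs_minus[OF H]
        hs_scaleC[OF H])
  \<comment> \<open>Substituting J m = x - z A x cancels the terms in A^2.\<close>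
  also have "- A (J m) + z *\<^sub>C (x - A (A x)) = z *\<^sub>C x - A x"
    unfolding x(2)[symmetric] using x(1)
    by (simp add: diff scaleC closed_op hs_scaleC[OF H] complex_vector.scale_right_diff_distrib)
  finally show ?thesis .
qed

text \<open>The generators of \<open>A\<Phi>\<close> are the images under D of those of A, because D
  commutes with A; by continuity D maps a dense span in H onto a dense part of its range.\<close>

lemma T_Phi_minimal:
  assumes "closure (complex_vector.span {(A ^^ n) (J m) |n m. m \<in> M}) = H"
  shows "minimal_system A\<Phi> M \<DD>"
proof -
  define X where "X = {(A ^^ n) (J m) |n m. m \<in> M}"
  have X: "X \<subseteq> H"
    by (auto simp: X_def funpow_in J_in)
  have pow: "(A ^^ n) (D x) = D ((A ^^ n) x)" if "x \<in> H" for n x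
    using that by (induction n) (auto simp: defect_commute funpow_in)
  have "blk_F A\<Phi> = A"
    by (simp add: fun_eq_iff T_Phi_blocks)
  then have "{(blk_F A\<Phi> ^^ n) (blk_Cadj A\<Phi> m) |n m. m \<in> M} = {(A ^^ n) (D (J m)) |n m. m \<in> M}"
    by (simp add: T_Phi_blocks)
  also have "\<dots> = {D ((A ^^ n) (J m)) |n m. m \<in> M}"
    using pow[OF J_in] by metis
  also have "\<dots> = D ` X"
    unfolding X_def by blast
  finally have gens: "{(blk_F A\<Phi> ^^ n) (blk_Cadj A\<Phi> m) |n m. m \<in> M} = D ` X" .
  have "closure (complex_vector.span (D ` X)) \<subseteq> \<DD>"
    unfolding defect_space_def using X
    by (intro closure_mono complex_vector.span_minimal subspace_defect_range) auto
  moreover have "\<DD> \<subseteq> closure (complex_vector.span (D ` X))"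
    unfolding defect_space_def
    using D.image_closure_span_subset[OF X] assms by (intro closure_minimal) (auto simp: X_def)
  ultimately show ?thesis
    by (simp add: minimal_system_def gens)
qed

section \<open>The compressed resolvent and its inverse\<close>

context
  fixes \<xi> :: complex
  assumes \<xi>: "\<xi> \<notin> complex_of_real ` {-1..1}"
begin

abbreviation "compressed_resolvent m \<equiv> P (inv_into H (\<lambda>x. A x - \<xi> *\<^sub>C x) (J m))"

text \<open>With x the resolvent at J m, the form of the compression at m is that of A - \<xi> I at
  x with its arguments exchanged. Coercivity therefore passes over, with \<open>cnj e\<close> in
  place of \<open>e\<close>.\<close>

lemma compressed_resolvent_invertible: "invertible_on M (\<lambda>m. compressed_resolvent m)"
proof -
  let ?R = "inv_into H (\<lambda>x. A x - \<xi> *\<^sub>C x)"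
  interpret R: bounded_operator H ?R
    using resolvent_invertible[OF \<xi>] H by unfold_locales (auto simp: invertible_on_def)
  obtain b where b: "b > 0" "\<And>x. x \<in> H \<Longrightarrow> norm (?R x) \<le> b * norm x"
    using R.bound by blast
  have "norm (compressed_resolvent m) \<le> b * norm m" if "m \<in> M" for m
    using norm_P[OF R.closed_op[OF J_in[OF that]]] b(2)[OF J_in[OF that]] that by (simp add: norm_J)
  then have "bounded_op_on M (\<lambda>m. compressed_resolvent m)"
    unfolding bounded_op_on_def
    by (auto simp: P_in P_add P_scaleC J_in J_add J_scaleC R.add R.scaleC R.closed_op)
  then interpret W: bounded_operator M "\<lambda>m. compressed_resolvent m"
    by unfold_locales (rule M)
  obtain d e where de: "d > 0" "\<And>a. \<bar>a\<bar> \<le> 1 \<Longrightarrow> d \<le> Re (e * (of_real a - \<xi>))"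
    using cut_interval_separation[OF \<xi>] by blast
  \<comment> \<open>A bound for the norm of A - \<xi> I, used to compare m with x.\<close>
  define q where "q = 1 + cmod \<xi>"
  have q: "q > 0"
    unfolding q_def by (smt (verit) norm_ge_zero)
  show ?thesis
  proof (rule W.coercive_invertible(1))
    show "d / q\<^sup>2 > 0"
      using de q by simp
    fix m assume m: "m \<in> M"
    define x where "x = ?R (J m)"
    have x: "x \<in> H" "A x - \<xi> *\<^sub>C x = J m"
      unfolding x_def using inv_op_in[OF resolvent_invertible[OF \<xi>]]
        op_inv_op[OF resolvent_invertible[OF \<xi>]] J_in[OF m] by auto
    have "norm m \<le> norm (A x) + norm (\<xi> *\<^sub>C x)"
      using norm_triangle_ineq4[of "A x" "\<xi> *\<^sub>C x"] by (simp add: x norm_J m)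
    also have "\<dots> \<le> q * norm x"
      using contr[OF x(1)] by (simp add: norm_scaleC q_def algebra_simps)
    finally have "(norm m)\<^sup>2 \<le> (q * norm x)\<^sup>2"
      by (intro power_mono) auto
    then have "d / q\<^sup>2 * (norm m)\<^sup>2 \<le> d * (norm x)\<^sup>2"
      using de(1) q by (simp add: field_simps)
    also have "\<dots> \<le> Re (e * cinner ((- \<xi>) *\<^sub>C x + 1 *\<^sub>C A x) x)"
      by (rule affine_coercive[OF _ x(1)]) (use de in simp)
    also have "(- \<xi>) *\<^sub>C x + 1 *\<^sub>C A x = J m"
      using x by simp
    also have "Re (e * cinner (J m) x) = Re (cnj e * cinner x (J m))"
      by (subst cinner_commute) simp
    also have "cinner x (J m) = cinner (P x) m"
      by (simp add: cinner_P x m)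
    finally show "d / q\<^sup>2 * (norm m)\<^sup>2 \<le> Re (cnj e * cinner (compressed_resolvent m) m)"
      by (simp add: x_def)
  qed
qed

text \<open>
  The Schur complement of \<open>A - \<xi> I\<close> in \<open>A\<Phi> - \<xi> I\<close> is \<open>\<xi>\<^sup>2 - 1\<close> times the compressed resolvent.
\<close>

lemma T_Phi_resolvent:
  assumes m: "m \<in> M"
  shows "fst (inv_into (M \<times> \<DD>) (\<lambda>x. A\<Phi> x - \<xi> *\<^sub>C x) (m, 0))
    = (1 / (\<xi>\<^sup>2 - 1)) *\<^sub>C inv_into M (\<lambda>m. compressed_resolvent m) m"
proof -
  have "\<xi>\<^sup>2 \<noteq> 1"
    using \<xi> by (force simp: power2_eq_1_iff)
  then have c: "(\<xi>\<^sup>2 - 1) * (1 / (\<xi>\<^sup>2 - 1)) = 1"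
    by simp
  define w where "w = inv_into M (\<lambda>m. compressed_resolvent m) m"
  define n where "n = (1 / (\<xi>\<^sup>2 - 1)) *\<^sub>C w"
  have w: "w \<in> M" "compressed_resolvent w = m"
    using inv_op_in[OF compressed_resolvent_invertible m]
      op_inv_op[OF compressed_resolvent_invertible m] by (auto simp: w_def)
  have n: "n \<in> M"
    by (simp add: n_def w hs_scaleC[OF M])
  have "compressed_resolvent n = (1 / (\<xi>\<^sup>2 - 1)) *\<^sub>C compressed_resolvent w"
    using compressed_resolvent_invertible w(1)
    by (auto simp: n_def invertible_on_def bounded_op_on_def)
  then have m_eq: "(\<xi>\<^sup>2 - 1) *\<^sub>C compressed_resolvent n = m"
    using c by (simp add: w scaleC_scaleC)
  \<comment> \<open>The second row of the system for (n, h) reads (A - \<xi>) h = - D (J n). With J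
    n = (A - \<xi>) x it is solved by h = - D x.\<close>
  define x where "x = inv_into H (\<lambda>x. A x - \<xi> *\<^sub>C x) (J n)"
  have x: "x \<in> H" "J n = A x - \<xi> *\<^sub>C x"
    unfolding x_def using inv_op_in[OF resolvent_invertible[OF \<xi>]]
      op_inv_op[OF resolvent_invertible[OF \<xi>]] J_in[OF n] by auto
  \<comment> \<open>The first row before compression: -A (A - \<xi>) - (I - A^2) - \<xi> (A - \<xi>)
    = (\<xi>^2 - 1) I.\<close>
  have "P (- A (J n) - D (D x) - \<xi> *\<^sub>C J n) = P ((\<xi>\<^sup>2 - 1) *\<^sub>C x)"
    unfolding x(2) using x(1)
    by (simp add: diff scaleC closed_op defect_square hs_scaleC[OF H] scaleC_scaleC power2_eq_square
        complex_vector.scale_right_diff_distrib complex_vector.scale_left_diff_distrib)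
  also have "\<dots> = m"
    using m_eq x(1) by (simp add: P_scaleC x_def)
  finally have "- P (A (J n)) - P (D (D x)) - \<xi> *\<^sub>C n = m"
    using x(1) n
    by (simp add: P_diff P_minus P_scaleC P_J J_in closed_op D.closed_op hs_diff[OF H]
        hs_minus[OF H] hs_scaleC[OF H])
  moreover have "D (J n) - D (A x) + \<xi> *\<^sub>C D x = 0"
    unfolding x(2) using x(1) by (simp add: D.diff D.scaleC closed_op hs_scaleC[OF H])
  ultimately have "A\<Phi> (n, - D x) - \<xi> *\<^sub>C (n, - D x) = (m, 0)"
    using x(1)
    by (simp add: T_Phi_eq scaleC_prod_def D.minus P_minus minus D.closed_op defect_commute)
  moreover have "(n, - D x) \<in> M \<times> \<DD>"
    using n x(1) by (simp add: hs_minus[OF hilbert_subspace_defect_space] defect_in_space)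
  ultimately have "inv_into (M \<times> \<DD>) (\<lambda>x. A\<Phi> x - \<xi> *\<^sub>C x) (m, 0) = (n, - D x)"
    by (intro inv_op_eq[OF \<Phi>.T.resolvent_invertible[OF \<xi>]])
  then show ?thesis
    by (simp add: n_def w_def)
qed

end

end

section \<open>The block operator of a passive system\<close>

context passive_system
begin

lemma compression_fst: "compression (M \<times> K) T M fst (\<lambda>m. (m, 0))"
  by unfold_locales (auto simp: subspaces scaleC_prod_def cinner_prod_def)

interpretation C: compression "M \<times> K" T M fst "\<lambda>m. (m, 0)"
  by (rule compression_fst)

lemma transfer_T_Phi:
  assumes z: "z \<in> cut_plane" and m: "m \<in> M"
  defines "n \<equiv> inv_into M (\<lambda>x. x - z *\<^sub>C transfer_function T K z x) m"
  shows "transfer_function C.A\<Phi> T.\<DD> z m = z *\<^sub>C n - transfer_function T K z n"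
  unfolding n_def transfer_cayley[OF z m] using C.T_Phi_transfer[OF z m] by simp

text \<open>
  The map \<open>w \<mapsto> (z - w) / (1 - z w)\<close> is an involution, so applying \<open>transfer_cayley\<close> to the
  system \<open>A\<Phi>\<close> recovers the transfer function of \<open>T\<close>.
\<close>

lemma transfer_eq_compressed_cayley:
  assumes z: "z \<in> cut_plane" and m: "m \<in> M"
  shows "transfer_function T K z m
    = fst (z *\<^sub>C inv_into (M \<times> T.\<DD>) (\<lambda>x. x - z *\<^sub>C C.A\<Phi> x) (m, 0)
        - C.A\<Phi> (inv_into (M \<times> T.\<DD>) (\<lambda>x. x - z *\<^sub>C C.A\<Phi> x) (m, 0)))"
proof -
  let ?\<Omega> = "transfer_function T K z" and ?\<Psi> = "transfer_function C.A\<Phi> T.\<DD> z"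
  interpret Psi: bounded_operator M ?\<Psi>
    by unfold_locales (simp_all add: subspaces C.\<Phi>.bounded_transfer[OF z])
  \<comment> \<open>At this vector the inverse inside \<Psi> cancels, so \<Psi> w = z m - \<Omega>
    m.\<close>
  define w where "w = m - z *\<^sub>C ?\<Omega> m"
  \<comment> \<open>The same factor 1 - z^2 arises from (I - z \<Psi>) w, as a multiple of m, and
    from z w - \<Psi> w, as a multiple of \<Omega> m.\<close>
  define c where "c = 1 / (1 - z\<^sup>2)"
  have "1 - z\<^sup>2 \<noteq> 0"
    using cut_plane_square[OF z] by simp
  then have c: "c * (1 - z\<^sup>2) = 1"
    by (simp add: c_def)
  have \<Omega>m: "?\<Omega> m \<in> M"
    using bounded_transfer[OF z] m by (auto simp: bounded_op_on_def)
  have w: "w \<in> M"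
    by (simp add: w_def hs_diff[OF subspaces(1)] hs_scaleC[OF subspaces(1)] m \<Omega>m)
  have "inv_into M (\<lambda>x. x - z *\<^sub>C ?\<Omega> x) w = m"
    by (rule inv_op_eq[OF transfer_pencil_invertible[OF z] m]) (simp add: w_def)
  then have \<Psi>w: "?\<Psi> w = z *\<^sub>C m - ?\<Omega> m"
    using transfer_T_Phi[OF z w] by simp
  have "w - z *\<^sub>C ?\<Psi> w = (1 - z\<^sup>2) *\<^sub>C m"
    unfolding \<Psi>w
    by (simp add: w_def complex_vector.scale_right_diff_distrib scaleC_scaleC power2_eq_square
        complex_vector.scale_left_diff_distrib)
  then have "c *\<^sub>C (w - z *\<^sub>C ?\<Psi> w) = m"
    using c by (simp add: scaleC_scaleC)
  then have "c *\<^sub>C w - z *\<^sub>C ?\<Psi> (c *\<^sub>C w) = m"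
    using w by (simp add: Psi.scaleC complex_vector.scale_right_diff_distrib scaleC_scaleC
        mult.commute)
  then have "inv_into M (\<lambda>x. x - z *\<^sub>C ?\<Psi> x) m = c *\<^sub>C w"
    by (intro inv_op_eq[OF C.\<Phi>.transfer_pencil_invertible[OF z]] hs_scaleC[OF subspaces(1)] w)
  then have "fst (z *\<^sub>C inv_into (M \<times> T.\<DD>) (\<lambda>x. x - z *\<^sub>C C.A\<Phi> x) (m, 0)
      - C.A\<Phi> (inv_into (M \<times> T.\<DD>) (\<lambda>x. x - z *\<^sub>C C.A\<Phi> x) (m, 0)))
      = z *\<^sub>C c *\<^sub>C w - ?\<Psi> (c *\<^sub>C w)"
    using C.\<Phi>.transfer_cayley[OF z m] by simp
  also have "\<dots> = c *\<^sub>C (z *\<^sub>C w - ?\<Psi> w)"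
    using w by (simp add: Psi.scaleC complex_vector.scale_right_diff_distrib scaleC_scaleC mult.commute)
  also have "z *\<^sub>C w - ?\<Psi> w = (1 - z\<^sup>2) *\<^sub>C ?\<Omega> m"
    unfolding \<Psi>w
    by (simp add: w_def complex_vector.scale_right_diff_distrib scaleC_scaleC power2_eq_square
        complex_vector.scale_left_diff_distrib)
  finally show ?thesis
    using c by (simp add: scaleC_scaleC)
qed

end

theorem theorem6p1:
  fixes T :: "'m::separable_hilbert_space \<times> 'k::separable_hilbert_space \<Rightarrow> 'm \<times> 'k"
    and M :: "'m set" and K :: "'k set"
    and S :: "'h::separable_hilbert_space \<Rightarrow> 'h"
    and N H :: "'h set"
  shows
    "(passive_selfadjoint_system T M K \<longrightarrow>
       (let \<Omega> = transfer_function T K;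
            \<DD> = defect_space (M \<times> K) T;
            T\<Phi> = T_Phi fst (\<lambda>m. (m, 0)) (M \<times> K) T
        in selfadjoint_contraction_on (M \<times> \<DD>) T\<Phi> \<and>
           passive_selfadjoint_system T\<Phi> M \<DD> \<and>
           (\<forall>z\<in>cut_plane.
              invertible_on K (\<lambda>k. k - z *\<^sub>C blk_F T k) \<and>
              invertible_on \<DD> (\<lambda>h. h - z *\<^sub>C blk_F T\<Phi> h) \<and>
              invertible_on M (\<lambda>m. m - z *\<^sub>C \<Omega> z m) \<and>
              (\<forall>m\<in>M. (\<lambda>x. z *\<^sub>C x - \<Omega> z x) (inv_into M (\<lambda>x. x - z *\<^sub>C \<Omega> z x) m)
                       = transfer_function T\<Phi> \<DD> z m)) \<and>
           (minimal_system T M K \<longrightarrow> minimal_system T\<Phi> M \<DD>)))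
     \<and>
     (hilbert_subspace H \<and> selfadjoint_contraction_on H S \<and> hilbert_subspace N \<and> N \<subseteq> H \<longrightarrow>
       (let \<DD> = defect_space H S;
            S\<Phi> = T_Phi (orth_proj N) (\<lambda>m. m) H S;
            W = (\<lambda>\<xi> m. orth_proj N (inv_into H (\<lambda>x. S x - \<xi> *\<^sub>C x) m))
        in \<forall>\<xi>. \<xi> \<notin> complex_of_real ` {-1..1} \<longrightarrow>
             invertible_on H (\<lambda>x. S x - \<xi> *\<^sub>C x) \<and>
             invertible_on N (W \<xi>) \<and>
             invertible_on (N \<times> \<DD>) (\<lambda>x. S\<Phi> x - \<xi> *\<^sub>C x) \<and>
             (\<forall>m\<in>N. (1 / (\<xi>\<^sup>2 - 1)) *\<^sub>C inv_into N (W \<xi>) m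
                      = fst (inv_into (N \<times> \<DD>) (\<lambda>x. S\<Phi> x - \<xi> *\<^sub>C x) (m, 0)))))
     \<and>
     (passive_selfadjoint_system T M K \<longrightarrow>
       (let \<Omega> = transfer_function T K;
            \<DD> = defect_space (M \<times> K) T;
            T\<Phi> = T_Phi fst (\<lambda>m. (m, 0)) (M \<times> K) T;
            \<Omega>t = (\<lambda>z x. (\<lambda>y. z *\<^sub>C y - T\<Phi> y) (inv_into (M \<times> \<DD>) (\<lambda>y. y - z *\<^sub>C T\<Phi> y) x))
        in \<forall>z\<in>cut_plane.
             invertible_on (M \<times> \<DD>) (\<lambda>y. y - z *\<^sub>C T\<Phi> y) \<and>
             (\<forall>m\<in>M. \<Omega> z m = fst (\<Omega>t z (m, 0)))))"
  (is "(?passive \<longrightarrow> ?part1) \<and> (?sub \<longrightarrow> ?part2) \<and> (?passive \<longrightarrow> ?part3)")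
proof (intro conjI impI)
  assume ?passive
  then interpret passive_system T M K
    by unfold_locales
  interpret C: compression "M \<times> K" T M fst "\<lambda>m. (m, 0)"
    by (rule compression_fst)
  show ?part1
    unfolding Let_def
    using C.T_Phi_selfadjoint_contraction C.\<Phi>.is_system F.pencil_invertible
      C.\<Phi>.F.pencil_invertible transfer_pencil_invertible transfer_T_Phi
      C.T_Phi_minimal[OF minimal_span]
    by simp
  show ?part3
    unfolding Let_def
    using C.\<Phi>.T.pencil_invertible transfer_eq_compressed_cayley by simp
next
  assume sub: ?sub
  then interpret S: compression H S N "orth_proj N" "\<lambda>m. m"
    by unfold_locales (auto simp: orth_proj_in cinner_orth_proj orth_proj_ident)
  show ?part2
    unfolding Let_def
    using S.resolvent_invertible S.compressed_resolvent_invertible S.\<Phi>.T.resolvent_invertible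
      S.T_Phi_resolvent
    by simp
qed

end
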